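(* Let $\mathcal{F}$ and $\mathcal{F}'$ be hereditary classes of graphs and let $\theta$ be a positive integer. Let $\mathcal{F}^*$ be a class of graphs such that for every $G\in\mathcal{F}^*$ there exists a tree-decomposition $(T,\mathcal{X})$ of $G$ of adhesion at most $\theta$, where $\mathcal{X}=(X_t:t\in V(T))$, such that for every $t\in V(T)$: (i) $G[X_t]\in\mathcal{F}$, and (ii) $\mathcal{F}'$ contains every graph that can be obtained from $G[X_t]$ by adding new vertices and new edges such that for each new vertex $v$ there exists a neighbor $t_v$ of $t$ in $T$ such that all neighbors of $v$ are contained in $X_t\cap X_{t_v}$. Then $\operatorname{ad}(\mathcal{F}^* )\le\max\{\operatorname{ad}(\mathcal{F}),\operatorname{ad}(\mathcal{F}'),1\}$.
   Context: All graphs are finite. A class of graphs is hereditary if it is closed under taking induced subgraphs. $G[S]$ denotes the subgraph induced by $S$. A tree-decomposition $(T,\mathcal{X})$ of $G$ has adhesion $\max_{tt'\in E(T)}|X_t\cap X_{t'}|$. For a graph $G$ and $x,y\in V(G)$, $d_G(x,y)$ is the minimum number of edges of a path in $G$ between $x$ and $y$. For a nonnegative integer $n$, an $n$-dimensional control function for a class $\mathcal{F}$ of graphs is a function $f:\mathbb{R}^+\to\mathbb{R}^+$ such that for every $G\in\mathcal{F}$ and every real $r>0$ there exist collections $\mathcal{U}_1,\dots,\mathcal{U}_{n+1}$ of subsets of $V(G)$ covering $V(G)$, such that for each $i$, whenever $U\neq U'$ are in $\mathcal{U}_i$ and $x\in U$, $x'\in U'$, we have $d_G(x,x')>r$, and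 whenever $x,x'$ lie in a common $U\in\mathcal{U}_i$ we have $d_G(x,x')\le f(r)$. The asymptotic dimension $\operatorname{ad}(\mathcal{F})$ is the minimum $n$ for which there is a common $n$-dimensional control function for all graphs in $\mathcal{F}$. *)

theory Defs
  imports "Graph_Theory.Digraph_Component" "HOL-Library.Extended_Real"
begin

type_synonym 'a ugraph = "'a pair_pre_digraph"

text \<open>
  A finite simple graph is a \<^typ>\<open>'a ugraph\<close> satisfying \<^const>\<open>pair_graph\<close>: a finite, loop-free,
  symmetric relation on a finite vertex set, so an undirected edge is a pair of opposite arcs.
  The null graph is allowed.
\<close>

definition induced :: "'a ugraph \<Rightarrow> 'a set \<Rightarrow> 'a ugraph" where
  "induced G S = \<lparr> pverts = S, parcs = parcs G \<inter> S \<times> S \<rparr>"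

text \<open>This is the induced subgraph of the library, on graphs without the arc projections.\<close>

lemma with_proj_induced: "with_proj (induced G S) = with_proj G \<restriction> S"
  by (auto simp: induced_def induce_subgraph_def with_proj_def)

text \<open>
  A class of graphs is a set of graphs with vertices in \<^typ>\<open>'a\<close>. Closure under isomorphism is not
  required.
\<close>

definition graph_class :: "'a ugraph set \<Rightarrow> bool" where
  "graph_class \<F> \<longleftrightarrow> (\<forall>G\<in>\<F>. pair_graph G)"

definition hereditary :: "'a ugraph set \<Rightarrow> bool" where
  "hereditary \<F> \<longleftrightarrow> (\<forall>G\<in>\<F>. \<forall>S. S \<subseteq> pverts G \<longrightarrow> induced G S \<in> \<F>)"

text \<open>The infimum over the empty set is \<open>\<infinity>\<close>: vertices in different components are at distance \<open>\<infinity>\<close>.\<close>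

definition gdist :: "'a ugraph \<Rightarrow> 'a \<Rightarrow> 'a \<Rightarrow> enat" where
  "gdist G x y = (INF p\<in>{p. pre_digraph.apath (with_proj G) x p y}. enat (length p))"

text \<open>
  \<^const>\<open>Digraph_Component.tree\<close> is unsuitable here: in a symmetric digraph every edge \<open>uv\<close> gives
  the cycle \<open>u, v, u\<close> of length 2. The cycles of an undirected graph are those of length at least 3.
\<close>

definition is_tree :: "'a ugraph \<Rightarrow> bool" where
  "is_tree T \<longleftrightarrow> pair_graph T \<and> Digraph_Component.connected (with_proj T) \<and>
     \<not> (\<exists>p. pre_digraph.cycle (with_proj T) p \<and> 3 \<le> length p)"

definition tree_decomposition :: "'t ugraph \<Rightarrow> ('t \<Rightarrow> 'a set) \<Rightarrow> 'a ugraph \<Rightarrow> bool" where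
  "tree_decomposition T X G \<longleftrightarrow>
     is_tree T \<and>
     (\<Union>t\<in>pverts T. X t) = pverts G \<and>
     (\<forall>(u, v)\<in>parcs G. \<exists>t\<in>pverts T. u \<in> X t \<and> v \<in> X t) \<and>
     (\<forall>v\<in>pverts G. Digraph_Component.connected (with_proj (induced T {t\<in>pverts T. v \<in> X t})))"

text \<open>The adhesion is 0 if \<open>T\<close> has no edge, since \<open>Sup {} = 0\<close> on \<^typ>\<open>nat\<close>.\<close>

definition adhesion :: "'t ugraph \<Rightarrow> ('t \<Rightarrow> 'a set) \<Rightarrow> nat" where
  "adhesion T X = (SUP (t, t')\<in>parcs T. card (X t \<inter> X t'))"

text \<open>
  \<open>H\<close> arises from \<open>G\<close> by adding new vertices and edges incident with them, where the
  neighbourhood of each new vertex lies in some member of \<open>\<A>\<close> (a family of subsets of \<open>V(G)\<close>).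
  Edges between old vertices are not added.
\<close>

definition vertex_extension :: "'a ugraph \<Rightarrow> 'a set set \<Rightarrow> 'a ugraph \<Rightarrow> bool" where
  "vertex_extension G \<A> H \<longleftrightarrow>
     pair_graph H \<and> pverts G \<subseteq> pverts H \<and> induced H (pverts G) = G \<and>
     (\<forall>v \<in> pverts H - pverts G. \<exists>A\<in>\<A>. {w. (v, w) \<in> parcs H} \<subseteq> A)"

definition control_function :: "nat \<Rightarrow> 'a ugraph set \<Rightarrow> (real \<Rightarrow> real) \<Rightarrow> bool" where
  "control_function n \<F> f \<longleftrightarrow>
     (\<forall>r>0. f r > 0) \<and>
     (\<forall>G\<in>\<F>. \<forall>r>0. \<exists>\<U> :: nat \<Rightarrow> 'a set set.
        (\<forall>i\<in>{1..n+1}. \<forall>U\<in>\<U> i. U \<subseteq> pverts G) \<and>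
        pverts G \<subseteq> (\<Union>i\<in>{1..n+1}. \<Union>(\<U> i)) \<and>
        (\<forall>i\<in>{1..n+1}. \<forall>U\<in>\<U> i. \<forall>U'\<in>\<U> i. U \<noteq> U' \<longrightarrow>
           (\<forall>x\<in>U. \<forall>x'\<in>U'. ereal_of_enat (gdist G x x') > ereal r)) \<and>
        (\<forall>i\<in>{1..n+1}. \<forall>U\<in>\<U> i. \<forall>x\<in>U. \<forall>x'\<in>U. ereal_of_enat (gdist G x x') \<le> ereal (f r)))"

text \<open>The asymptotic dimension is \<open>\<infinity>\<close> if there is no control function of any dimension.\<close>

definition asdim :: "'a ugraph set \<Rightarrow> enat" where
  "asdim \<F> = (INF n\<in>{n. \<exists>f. control_function n \<F> f}. enat n)"

end

theory Submission
  imports Defs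
begin

text \<open>
  The class \<open>\<F>'\<close> controls the bags with the metric of the whole graph: at scale \<open>r\<close>, a new vertex
  joined to \<open>u\<close> and \<open>v\<close>, for every pair \<open>u, v\<close> in a common adhesion set at distance at most \<open>r\<close>,
  makes up for the walks leaving the bag, and it shortens distances only by a bounded factor.

  A cover of dimension \<open>n\<close> is treated as a colouring with \<open>n + 1\<close> colours whose monochromatic
  \<open>r\<close>-chains have bounded extent. Changing such a colouring on boundedly many balls of bounded
  radius keeps it bounded. The colourings of the bags are glued by induction on the maximal number
  \<open>\<eta>\<close> of points that an adhesion set has outside the balls around a bounded set \<open>Z\<close> of centres. For
  \<open>\<eta> = 0\<close> the bags are separated by these balls. Otherwise the rooted tree is cut, from the root
  downwards, at every adhesion set with \<open>\<eta>\<close> points away from both \<open>Z\<close> and the previous cut. Each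
  chunk between cuts is coloured by induction, with the upper cut added to \<open>Z\<close>, and at each cut three
  concentric rings (the colours of the chunk above, colour 0, colour 1) stop the chains from passing.
  This is where at least two colours are needed.
\<close>

section \<open>Colourings with bounded monochromatic chains\<close>

text \<open>Distance at most \<open>k\<close> in the graph with arc relation \<open>E\<close>,
  expressed by walks: no vertex set is needed, and points at infinite distance are
  \<open>near\<close> for no \<open>k\<close>.\<close>

definition near :: "'a rel \<Rightarrow> nat \<Rightarrow> 'a \<Rightarrow> 'a \<Rightarrow> bool" where
  "near E k x y \<longleftrightarrow> (\<exists>j\<le>k. (x, y) \<in> E ^^ j)"

lemma near_refl [simp]: "near E k x x"
  unfolding near_def by (intro exI[of _ 0]) auto

lemma near_mono: "near E k x y \<Longrightarrow> k \<le> l \<Longrightarrow> near E l x y"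
  unfolding near_def by (meson order_trans)

lemma near_trans: "near E k x y \<Longrightarrow> near E l y z \<Longrightarrow> near E (k + l) x z"
  unfolding near_def by (meson add_mono relpow_trans)

lemma near_sym:
  assumes "sym E" "near E k x y"
  shows "near E k y x"
proof -
  have "(y, x) \<in> E ^^ j" if "(x, y) \<in> E ^^ j" for j x y
    using that
  proof (induction j arbitrary: x)
    case (Suc j)
    then obtain z where "(x, z) \<in> E" "(z, y) \<in> E ^^ j"
      by (meson relpow_Suc_D2)
    with Suc.IH \<open>sym E\<close> show ?case
      by (auto dest: symD)
  qed auto
  with assms show ?thesis
    unfolding near_def by blast
qed

definition nbhd :: "'a rel \<Rightarrow> 'a set \<Rightarrow> nat \<Rightarrow> 'a set" where
  "nbhd E Z k = {x. \<exists>z\<in>Z. near E k z x}"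

lemma nbhd_trans: "x \<in> nbhd E Z k \<Longrightarrow> near E l x y \<Longrightarrow> k + l \<le> m \<Longrightarrow> y \<in> nbhd E Z m"
  unfolding nbhd_def by (blast intro: near_mono near_trans)

lemma nbhd_mono: "x \<in> nbhd E Z k \<Longrightarrow> k \<le> m \<Longrightarrow> x \<in> nbhd E Z m"
  using nbhd_trans[of x E Z k 0 x m] by simp

definition mono_step :: "'a rel \<Rightarrow> 'a set \<Rightarrow> ('a \<Rightarrow> nat) \<Rightarrow> nat \<Rightarrow> 'a rel" where
  "mono_step E Y c r = {(x, y). x \<in> Y \<and> y \<in> Y \<and> c x = c y \<and> near E r x y}"

text \<open>This is a weak diameter: chains stay in \<open>Y\<close>, but steps and extent are
  measured in the ambient graph \<open>E\<close>. The sets of a cover become the monochromatic chain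
  components, so sets of one colour are separated at scale \<open>r\<close> automatically.\<close>

definition bounded_col :: "'a rel \<Rightarrow> 'a set \<Rightarrow> ('a \<Rightarrow> nat) \<Rightarrow> nat \<Rightarrow> nat \<Rightarrow> bool" where
  "bounded_col E Y c r D \<longleftrightarrow> (\<forall>x y. (x, y) \<in> (mono_step E Y c r)\<^sup>* \<longrightarrow> near E D x y)"

lemma bounded_colD: "bounded_col E Y c r D \<Longrightarrow> (x, y) \<in> (mono_step E Y c r)\<^sup>* \<Longrightarrow> near E D x y"
  by (auto simp: bounded_col_def)

lemma bounded_col_mono: "bounded_col E Y c r D \<Longrightarrow> D \<le> D' \<Longrightarrow> bounded_col E Y c r D'"
  by (auto simp: bounded_col_def intro: near_mono)

lemma sym_mono_step: "sym E \<Longrightarrow> sym ((mono_step E Y c r)\<^sup>*)"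
  by (intro sym_rtrancl) (auto simp: mono_step_def sym_def intro: near_sym)

text \<open>A label that no monochromatic step changes is constant along every chain, so it suffices
  to bound chains within each label class.\<close>

lemma bounded_col_partition:
  assumes bounded: "\<And>b. bounded_col E {x \<in> Y. l x = b} c r D"
    and level: "\<And>x y. x \<in> Y \<Longrightarrow> y \<in> Y \<Longrightarrow> c x = c y \<Longrightarrow> near E r x y \<Longrightarrow> l x = l y"
  shows "bounded_col E Y c r D"
  unfolding bounded_col_def
proof (intro allI impI)
  fix x y assume "(x, y) \<in> (mono_step E Y c r)\<^sup>*"
  then have "(x, y) \<in> (mono_step E {y \<in> Y. l y = l x} c r)\<^sup>* \<and> l y = l x"
  proof induction
    case (step y z)
    then have "(y, z) \<in> mono_step E {y \<in> Y. l y = l x} c r" "l z = l x"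
      using level[of y z] by (auto simp: mono_step_def)
    with step.IH show ?case
      by (meson rtrancl.rtrancl_into_rtrancl)
  qed auto
  with bounded[of "l x"] show "near E D x y"
    by (blast intro: bounded_colD)
qed

text \<open>Follow the chain up to its first entry into \<open>B\<close>: the part before avoids
  \<open>B\<close> and ends within \<open>r\<close> of it.\<close>

lemma mono_step_avoids_or_hits:
  assumes "(x, y) \<in> (mono_step E Y c r)\<^sup>*"
  shows "(x, y) \<in> (mono_step E (Y - B) c r)\<^sup>* \<or>
    (\<exists>b\<in>B. \<exists>x'. (x, x') \<in> (mono_step E (Y - B) c r)\<^sup>* \<and> near E r x' b)"
  using assms
proof induction
  case (step y z)
  consider "z \<in> B" | "y \<in> B" | "y \<notin> B" "z \<notin> B"
    by blast
  then show ?case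
  proof cases
    case 1
    with step show ?thesis
      by (auto simp: mono_step_def)
  next
    case 2
    with step.IH show ?thesis
      using near_refl[of E r y] by blast
  next
    case 3
    with step.hyps have "(y, z) \<in> mono_step E (Y - B) c r"
      by (auto simp: mono_step_def)
    with step.IH show ?thesis
      by (meson rtrancl.rtrancl_into_rtrancl)
  qed
qed auto

text \<open>A chain that meets the ball brings each of its ends close to the centre:
  \<open>D\<close> along the part before the ball, \<open>r\<close> for the step into it,
  \<open>\<rho>\<close> on to \<open>z\<close>. A chain missing the ball has extent
  \<open>D\<close>.\<close>

lemma bounded_col_ball:
  assumes "sym E" and bounded: "bounded_col E (Y - nbhd E {z} \<rho>) c r D"
  shows "bounded_col E Y c r (2 * (D + r + \<rho>))"
  unfolding bounded_col_def
proof (intro allI impI)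
  let ?R = "mono_step E (Y - nbhd E {z} \<rho>) c r"
  have centre: "(x, y) \<in> ?R\<^sup>* \<or> near E (D + r + \<rho>) x z"
    if "(x, y) \<in> (mono_step E Y c r)\<^sup>*" for x y
  proof (rule disjCI)
    assume "\<not> near E (D + r + \<rho>) x z"
    have False if "b \<in> nbhd E {z} \<rho>" "(x, x') \<in> ?R\<^sup>*" "near E r x' b" for b x'
    proof -
      have "near E D x x'"
        using bounded that by (blast intro: bounded_colD)
      moreover have "near E \<rho> b z"
        using that \<open>sym E\<close> by (auto simp: nbhd_def intro: near_sym)
      ultimately show False
        using \<open>\<not> near E (D + r + \<rho>) x z\<close> \<open>near E r x' b\<close> near_trans by metis
    qed
    with mono_step_avoids_or_hits[OF that] show "(x, y) \<in> ?R\<^sup>*"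
      by blast
  qed
  \<comment> \<open>Apply \<open>centre\<close> from both ends: unless one application gives a chain
    outside the ball, both ends are close to \<open>z\<close>.\<close>
  fix x y assume xy: "(x, y) \<in> (mono_step E Y c r)\<^sup>*"
  then have yx: "(y, x) \<in> (mono_step E Y c r)\<^sup>*"
    using sym_mono_step[OF \<open>sym E\<close>] by (meson symD)
  consider "(x, y) \<in> ?R\<^sup>*" | "(y, x) \<in> ?R\<^sup>*"
    | "near E (D + r + \<rho>) x z" "near E (D + r + \<rho>) y z"
    using centre xy yx by blast
  then show "near E (2 * (D + r + \<rho>)) x y"
  proof cases
    case 1
    then show ?thesis
      using bounded by (auto dest: bounded_colD intro: near_mono)
  next
    case 2
    then have "near E D y x"
      using bounded by (auto dest: bounded_colD)
    then show ?thesis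
      using near_mono[OF near_sym[OF \<open>sym E\<close>], of D y x "2 * (D + r + \<rho>)"] by simp
  next
    case 3
    then show ?thesis
      using near_trans[OF 3(1) near_sym[OF \<open>sym E\<close> 3(2)]] by (simp only: mult_2)
  qed
qed

definition centred_bound :: "nat \<Rightarrow> nat \<Rightarrow> nat \<Rightarrow> nat \<Rightarrow> nat" where
  "centred_bound k r \<rho> D = ((\<lambda>D. 2 * (D + r + \<rho>)) ^^ k) D"

lemma centred_bound_mono: "k \<le> l \<Longrightarrow> centred_bound k r \<rho> D \<le> centred_bound l r \<rho> D"
  by (induction rule: dec_induct) (auto simp: centred_bound_def)

text \<open>The balls are restored one at a time, each costing one application of the map iterated
  in \<open>centred_bound\<close>. The result depends on the number of balls, not on the
  graph.\<close>

lemma bounded_col_nbhd_exact: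
  assumes "sym E" "finite Z" "bounded_col E (Y - nbhd E Z \<rho>) c r D"
  shows "bounded_col E Y c r (centred_bound (card Z) r \<rho> D)"
  using assms(2,3)
proof (induction Z arbitrary: D)
  case empty
  then show ?case by (simp add: centred_bound_def nbhd_def)
next
  case (insert z Z)
  have "Y - nbhd E (insert z Z) \<rho> = (Y - nbhd E Z \<rho>) - nbhd E {z} \<rho>"
    by (auto simp: nbhd_def)
  then have "bounded_col E (Y - nbhd E Z \<rho>) c r (2 * (D + r + \<rho>))"
    using insert.prems bounded_col_ball[OF \<open>sym E\<close>] by metis
  then have "bounded_col E Y c r (centred_bound (card Z) r \<rho> (2 * (D + r + \<rho>)))"
    by (rule insert.IH)
  then show ?case
    using insert.hyps by (simp add: centred_bound_def funpow_Suc_right del: funpow.simps)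
qed

lemma bounded_col_nbhd:
  assumes "sym E" "finite Z" "card Z \<le> k" "bounded_col E (Y - nbhd E Z \<rho>) c r D"
  shows "bounded_col E Y c r (centred_bound k r \<rho> D)"
  using bounded_col_mono[OF bounded_col_nbhd_exact centred_bound_mono] assms by blast

section \<open>Rooted trees with numbered nodes\<close>

locale par_tree =
  fixes par :: "nat \<Rightarrow> nat"
  assumes par_0: "par 0 = 0" and par_less: "i > 0 \<Longrightarrow> par i < i"
begin

text \<open>The ancestor comes first. Since \<open>par\<close> decreases and fixes the root
  \<open>0\<close>, ancestors never have larger numbers; this gives antisymmetry and lets inductions
  along the tree run over the number.\<close>

definition desc :: "nat \<Rightarrow> nat \<Rightarrow> bool" where
  "desc i s \<longleftrightarrow> (\<exists>k. (par ^^ k) s = i)"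

lemma desc_refl [simp]: "desc i i"
  unfolding desc_def by (intro exI[of _ 0]) auto

lemma desc_par: "desc i (par s) \<Longrightarrow> desc i s"
  unfolding desc_def by (metis comp_apply funpow_Suc_right)

lemma desc_parD: "desc i s \<Longrightarrow> i \<noteq> s \<Longrightarrow> desc i (par s)"
  unfolding desc_def by (metis comp_apply funpow_0 funpow_Suc_right not0_implies_Suc)

lemma desc_trans: "desc i j \<Longrightarrow> desc j s \<Longrightarrow> desc i s"
  unfolding desc_def by (metis comp_apply funpow_add)

lemma par_le: "par i \<le> i"
  using par_0 par_less[of i] by (cases i) auto

lemma desc_le: "desc i s \<Longrightarrow> i \<le> s"
proof (induction s arbitrary: i rule: less_induct)
  case (less s)
  show ?case
  proof (cases "i = s \<or> s = 0")
    case True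
    have "(par ^^ k) 0 = 0" for k
      by (induction k) (auto simp: par_0)
    with True less.prems show ?thesis
      by (auto simp: desc_def)
  next
    case False
    then have "desc i (par s)"
      using less.prems by (auto dest: desc_parD)
    with less.IH[of "par s" i] par_less[of s] False show ?thesis
      by auto
  qed
qed

lemma desc_antisym: "desc i s \<Longrightarrow> desc s i \<Longrightarrow> i = s"
  by (meson desc_le order_antisym)

end

text \<open>
  \<open>N\<close> is the node set of a subtree with root \<open>a\<close>. Distances are taken in the ambient graph \<open>E\<close>,
  so that a subtree inherits the separation property from the whole tree.
\<close>

locale rooted_decomp = par_tree par for par :: "nat \<Rightarrow> nat" +
  fixes E :: "'a rel" and X :: "nat \<Rightarrow> 'a set" and N :: "nat set" and a :: nat
  assumes sym_E: "sym E"
    and root_in: "a \<in> N"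
    and desc_root: "i \<in> N \<Longrightarrow> desc a i"
    and par_in: "i \<in> N \<Longrightarrow> i \<noteq> a \<Longrightarrow> par i \<in> N"
    and separation: "i \<in> N \<Longrightarrow> i \<noteq> a \<Longrightarrow> s \<in> N \<Longrightarrow> s' \<in> N \<Longrightarrow> desc i s \<Longrightarrow> \<not> desc i s' \<Longrightarrow>
      x \<in> X s \<Longrightarrow> y \<in> X s' \<Longrightarrow> near E k x y \<Longrightarrow>
      \<exists>u\<in>X i \<inter> X (par i). near E k x u \<and> near E k u y"
begin

lemma par_lt: "i \<in> N \<Longrightarrow> i \<noteq> a \<Longrightarrow> par i < i"
  using desc_root[of i] desc_le[of a i] by (intro par_less) auto

end

text \<open>Outside the balls of radius \<open>\<rho> + r\<close>, no step of length
  \<open>r\<close> joins points assigned to different bags: it would meet an adhesion set within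
  \<open>r\<close>, and that set lies within \<open>\<rho>\<close> of \<open>Z\<close>. So chains
  stay in one bag, and the balls are restored afterwards.\<close>

lemma colouring_adhesions_covered:
  assumes "rooted_decomp par E X N a" "finite Z" "card Z \<le> k"
    and covered: "\<And>i. i \<in> N \<Longrightarrow> i \<noteq> a \<Longrightarrow> X i \<inter> X (par i) \<subseteq> nbhd E Z \<rho>"
    and bags: "\<And>i. i \<in> N \<Longrightarrow> \<exists>c. (\<forall>x. c x \<le> n) \<and> bounded_col E (X i) c r D"
  shows "\<exists>c. (\<forall>x. c x \<le> n) \<and>
    bounded_col E (\<Union>i\<in>N. X i) c r (centred_bound k r (\<rho> + r) D)"
proof -
  interpret rooted_decomp par E X N a by fact
  define core where "core = (\<Union>i\<in>N. X i) - nbhd E Z (\<rho> + r)"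
  \<comment> \<open>A point in several bags is assigned to an arbitrary one of them, and its colour
    is read off there.\<close>
  define nu where "nu x = (SOME i. i \<in> N \<and> x \<in> X i)" for x
  have nu: "nu x \<in> N" "x \<in> X (nu x)" if "x \<in> core" for x
    using someI_ex[of "\<lambda>i. i \<in> N \<and> x \<in> X i"] that by (auto simp: nu_def core_def)
  obtain cc where cc: "\<And>i x. i \<in> N \<Longrightarrow> cc i x \<le> n"
      "\<And>i. i \<in> N \<Longrightarrow> bounded_col E (X i) (cc i) r D"
    using bags by metis
  define c where "c x = (if nu x \<in> N then cc (nu x) x else 0)" for x
  \<comment> \<open>By symmetry of \<open>near\<close> this also holds with \<open>x\<close> and
    \<open>y\<close> exchanged, so the two nodes agree.\<close>
  have cross: "desc (nu x) (nu y)" if xy: "x \<in> core" "y \<in> core" "near E r x y" for x y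
  proof (rule ccontr)
    assume not_desc: "\<not> desc (nu x) (nu y)"
    then have "nu x \<noteq> a"
      using desc_root nu(1)[OF xy(2)] by auto
    obtain u where u: "u \<in> X (nu x) \<inter> X (par (nu x))" "near E r x u"
      using separation[OF nu(1)[OF xy(1)] \<open>nu x \<noteq> a\<close> nu(1)[OF xy(1)] nu(1)[OF xy(2)] desc_refl
          not_desc nu(2)[OF xy(1)] nu(2)[OF xy(2)] xy(3)] by blast
    have "x \<in> nbhd E Z (\<rho> + r)"
      using covered[OF nu(1)[OF xy(1)] \<open>nu x \<noteq> a\<close>] near_sym[OF sym_E u(2)] u(1)
      by (blast intro: nbhd_trans[OF _ _ order_refl])
    with xy show False
      by (simp add: core_def)
  qed
  have "bounded_col E core c r D"
  proof (rule bounded_col_partition[where l = nu])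
    fix x y assume "x \<in> core" "y \<in> core" "near E r x y"
    then show "nu x = nu y"
      using cross near_sym[OF sym_E] by (blast intro: desc_antisym)
  next
    fix b
    show "bounded_col E {x \<in> core. nu x = b} c r D"
    proof (cases "b \<in> N")
      case True
      then have "c x = cc b x" "x \<in> X b" if "x \<in> core" "nu x = b" for x
        using nu(2) that by (auto simp: c_def)
      then have "mono_step E {x \<in> core. nu x = b} c r \<subseteq> mono_step E (X b) (cc b) r"
        unfolding mono_step_def by clarsimp
      then have "(mono_step E {x \<in> core. nu x = b} c r)\<^sup>* \<subseteq> (mono_step E (X b) (cc b) r)\<^sup>*"
        by (rule rtrancl_mono)
      with cc(2)[OF True] show ?thesis
        unfolding bounded_col_def by blast
    next
      case False
      then have "mono_step E {x \<in> core. nu x = b} c r = {}"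
        using nu(1) by (auto simp: mono_step_def)
      then show ?thesis
        by (simp add: bounded_col_def)
    qed
  qed
  moreover have "\<forall>x. c x \<le> n"
    using cc(1) by (auto simp: c_def)
  ultimately show ?thesis
    using bounded_col_nbhd[OF sym_E \<open>finite Z\<close> \<open>card Z \<le> k\<close>] unfolding core_def by blast
qed

text \<open>The greedy cut from the root downwards: the value is the root of the chunk containing
  \<open>i\<close>, and \<open>Q b i\<close> decides whether \<open>i\<close> starts a new chunk
  below the chunk rooted at \<open>b\<close>. The guard \<open>par i < i\<close> gives termination
  for arbitrary \<open>par\<close>.\<close>

function anchor :: "(nat \<Rightarrow> nat) \<Rightarrow> (nat \<Rightarrow> nat \<Rightarrow> bool) \<Rightarrow> nat \<Rightarrow> nat" where
  "anchor par Q i =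
    (if par i < i then if Q (anchor par Q (par i)) i then i else anchor par Q (par i) else i)"
  by auto
termination
  by (relation "Wellfounded.measure (\<lambda>(par, Q, i). i)") auto

declare anchor.simps [simp del]

section \<open>Cutting a rooted decomposition\<close>

locale cut_decomp = rooted_decomp par E X N a
  for par :: "nat \<Rightarrow> nat" and E :: "'a rel" and X :: "nat \<Rightarrow> 'a set" and N a +
  fixes Z :: "'a set" and \<rho> r \<eta> :: nat
  assumes finite_adh: "i \<in> N \<Longrightarrow> i \<noteq> a \<Longrightarrow> finite (X i \<inter> X (par i))"
    and card_adh: "i \<in> N \<Longrightarrow> i \<noteq> a \<Longrightarrow> card (X i \<inter> X (par i) - nbhd E Z \<rho>) \<le> Suc \<eta>"
begin

text \<open>For the root of \<open>N\<close>, the set \<open>X a \<inter> X (par a)\<close> leads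
  out of the subtree and is replaced by \<open>{}\<close>.\<close>

definition far_adh :: "nat \<Rightarrow> 'a set" where
  "far_adh b = (if b = a then {} else X b \<inter> X (par b) - nbhd E Z \<rho>)"

text \<open>The enlarged radius serves two purposes. A cut adhesion set keeps
  \<open>\<eta> + 1\<close> points farther than \<open>3 * r\<close> from the cut above, which
  leaves room for the rings. An uncut one has at most \<open>\<eta>\<close> points outside the new
  balls, so the induction hypothesis applies to the chunk.\<close>

definition cut :: "nat \<Rightarrow> nat \<Rightarrow> bool" where
  "cut b i \<longleftrightarrow> i = a \<or>
    Suc \<eta> \<le> card (X i \<inter> X (par i) - nbhd E (Z \<union> far_adh b) (\<rho> + 3 * r))"

abbreviation anch :: "nat \<Rightarrow> nat" where "anch \<equiv> anchor par cut"

abbreviation up :: "nat \<Rightarrow> nat" where "up b \<equiv> anch (par b)"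

lemma anch_root: "anch a = a"
  by (subst anchor.simps) (simp add: cut_def)

lemma anch_eq: "i \<in> N \<Longrightarrow> i \<noteq> a \<Longrightarrow> anch i = (if cut (up i) i then i else up i)"
  using par_lt by (subst anchor.simps) simp

lemma anch_in_desc: "i \<in> N \<Longrightarrow> anch i \<in> N \<and> desc (anch i) i \<and> anch (anch i) = anch i"
proof (induction i rule: less_induct)
  case (less i)
  show ?case
  proof (cases "i = a")
    case False
    then have "up i \<in> N \<and> desc (up i) (par i) \<and> anch (up i) = up i"
      using less par_lt par_in by blast
    with less.prems False anch_eq[of i] show ?thesis
      by (auto intro: desc_par)
  qed (use root_in anch_root in auto)
qed

lemmas anch_in = anch_in_desc[THEN conjunct1]
  and anch_desc = anch_in_desc[THEN conjunct2, THEN conjunct1]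
  and anch_idem = anch_in_desc[THEN conjunct2, THEN conjunct2]

text \<open>A node that is not a chunk root has the anchor of its parent, so \<open>anch i\<close>
  is the lowest chunk root above \<open>i\<close>.\<close>

lemma anch_nearest: "i \<in> N \<Longrightarrow> desc j i \<Longrightarrow> anch j = j \<Longrightarrow> desc j (anch i)"
proof (induction i rule: less_induct)
  case (less i)
  show ?case
  proof (cases "anch i = i")
    case False
    then have "i \<noteq> a"
      using anch_root by blast
    moreover from this have "anch i = up i"
      using False less.prems anch_eq[of i] by presburger
    moreover have "desc j (par i)"
      using less.prems False by (auto dest: desc_parD)
    ultimately show ?thesis
      using less.IH[of "par i"] less.prems par_lt[of i] par_in[of i] by presburger
  qed (use less.prems in simp)
qed

lemma up_lt: "b \<in> N \<Longrightarrow> b \<noteq> a \<Longrightarrow> up b < b"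
  using anch_desc[of "par b"] par_in[of b] par_lt[of b] desc_le by fastforce

lemma up_in: "b \<in> N \<Longrightarrow> b \<noteq> a \<Longrightarrow> up b \<in> N"
  by (blast intro: anch_in par_in)

lemma up_idem: "b \<in> N \<Longrightarrow> b \<noteq> a \<Longrightarrow> anch (up b) = up b"
  by (blast intro: anch_idem par_in)

lemma up_desc: "b \<in> N \<Longrightarrow> b \<noteq> a \<Longrightarrow> desc (up b) b"
  by (blast intro: anch_desc par_in desc_par)

lemma desc_up: "b \<in> N \<Longrightarrow> b \<noteq> a \<Longrightarrow> desc j b \<Longrightarrow> j \<noteq> b \<Longrightarrow> anch j = j \<Longrightarrow> desc j (up b)"
  by (blast intro: anch_nearest par_in desc_parD)

lemma far_adh_finite_card:
  assumes "b \<in> N" shows "finite (far_adh b)" "card (far_adh b) \<le> Suc \<eta>"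
  using assms finite_adh[of b] card_adh[of b] by (auto simp: far_adh_def)

text \<open>All of the \<open>\<eta> + 1\<close> points that a cut adhesion may have away from \<open>Z\<close> are used up by the cut.\<close>

lemma far_adh_separated:
  assumes "b \<in> N" "anch b = b" "b \<noteq> a" "u \<in> far_adh b"
  shows "u \<notin> nbhd E (far_adh (up b)) (3 * r)"
proof -
  let ?A = "X b \<inter> X (par b) - nbhd E (Z \<union> far_adh (up b)) (\<rho> + 3 * r)"
  have "cut (up b) b"
    using assms(1-3) anch_eq[of b] up_lt[of b] by (metis less_irrefl)
  then have "card (far_adh b) \<le> card ?A"
    using assms card_adh[of b] by (auto simp: cut_def far_adh_def)
  moreover have "?A \<subseteq> far_adh b"
    using assms nbhd_mono[of _ E Z \<rho> "\<rho> + 3 * r"] by (auto simp: far_adh_def nbhd_def)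
  ultimately have "far_adh b = ?A"
    using far_adh_finite_card[OF \<open>b \<in> N\<close>] by (metis card_subset_eq card_mono order_antisym)
  with assms(4) show ?thesis
    using nbhd_mono[of u E "far_adh (up b)" "3 * r" "\<rho> + 3 * r"] by (auto simp: nbhd_def)
qed

definition core :: "'a set" where
  "core = (\<Union>i\<in>N. X i) - nbhd E Z (\<rho> + r)"

definition bag_of :: "'a \<Rightarrow> nat" where
  "bag_of x = (SOME i. i \<in> N \<and> x \<in> X i)"

lemma bag_of: "x \<in> core \<Longrightarrow> bag_of x \<in> N" "x \<in> core \<Longrightarrow> x \<in> X (bag_of x)"
  using someI_ex[of "\<lambda>i. i \<in> N \<and> x \<in> X i"] by (auto simp: bag_of_def core_def)

abbreviation an :: "'a \<Rightarrow> nat" where "an x \<equiv> anch (bag_of x)"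

abbreviation ring :: "nat \<Rightarrow> 'a \<Rightarrow> bool" where
  "ring k x \<equiv> x \<in> nbhd E (far_adh (an x)) (k * r)"

text \<open>Points within \<open>2 * r\<close> of the cut above their chunk are counted to the
  parent chunk. This is the label for \<open>bounded_col_partition\<close>: a chain may cross a cut
  inside ring 1, but it cannot pass the boundary of ring 2.\<close>

definition lev :: "'a \<Rightarrow> nat" where
  "lev x = (if ring 2 x then up (an x) else an x)"

lemma an: "x \<in> core \<Longrightarrow> an x \<in> N" "x \<in> core \<Longrightarrow> anch (an x) = an x"
  "x \<in> core \<Longrightarrow> desc (an x) (bag_of x)"
  by (auto intro: anch_in anch_idem anch_desc bag_of)

lemma ring_mono: "ring k x \<Longrightarrow> k \<le> l \<Longrightarrow> ring l x"
  by (erule nbhd_mono) simp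

text \<open>The separating point \<open>u\<close> is within \<open>r\<close> of \<open>x\<close>. As
  \<open>x\<close> is outside the balls of radius \<open>\<rho> + r\<close>, \<open>u\<close> is
  outside those of radius \<open>\<rho>\<close> and so belongs to \<open>far_adh b\<close>.\<close>

lemma cross:
  assumes "x \<in> core" "y \<in> core" "near E r x y"
    and "b \<in> N" "desc b (bag_of x)" "\<not> desc b (bag_of y)"
  shows "b \<noteq> a" "\<exists>u\<in>far_adh b. near E r u x \<and> near E r u y"
proof -
  show "b \<noteq> a"
    using assms bag_of desc_root by blast
  then obtain u where u: "u \<in> X b \<inter> X (par b)" "near E r x u" "near E r u y"
    using separation[of b "bag_of x" "bag_of y" x y r] assms bag_of by blast
  then have "near E r u x"
    using near_sym[OF sym_E] by blast
  moreover from this have "u \<notin> nbhd E Z \<rho>"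
    using assms(1) nbhd_trans[of u E Z \<rho> r x "\<rho> + r"] by (auto simp: core_def)
  ultimately show "\<exists>u\<in>far_adh b. near E r u x \<and> near E r u y"
    using u \<open>b \<noteq> a\<close> by (auto simp: far_adh_def)
qed

text \<open>One step cannot cross two consecutive cuts: the crossing points would be within
  \<open>2 * r\<close> of each other, against \<open>far_adh_separated\<close>.\<close>

lemma cross_up:
  assumes "x \<in> core" "y \<in> core" "near E r x y" "\<not> desc (an x) (bag_of y)"
  shows "desc (up (an x)) (bag_of y)"
proof (rule ccontr)
  assume up: "\<not> desc (up (an x)) (bag_of y)"
  obtain u where u: "an x \<noteq> a" "u \<in> far_adh (an x)" "near E r u x" "near E r u y"
    using cross[OF assms(1-3) an(1)[OF assms(1)] an(3)[OF assms(1)] assms(4)] by blast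
  have "up (an x) \<in> N" "desc (up (an x)) (bag_of x)"
    using an[OF assms(1)] u up_in up_desc by (blast intro: desc_trans)+
  then obtain v where v: "v \<in> far_adh (up (an x))" "near E r v x"
    using cross(2)[OF assms(1-3)] up by blast
  have "near E (r + r) v u"
    by (rule near_trans[OF v(2) near_sym[OF sym_E u(3)]])
  then have "u \<in> nbhd E (far_adh (up (an x))) (3 * r)"
    using v near_mono[of E "r + r" v u "3 * r"] by (auto simp: nbhd_def)
  with far_adh_separated an assms u show False
    by blast
qed

lemma desc_disjoint_anchors:
  assumes "x \<in> core" "y \<in> core" "an x \<noteq> an y" "desc (an x) (bag_of y)"
  shows "\<not> desc (an y) (bag_of x)"
proof
  assume "desc (an y) (bag_of x)"
  then have "desc (an y) (an x)" "desc (an x) (an y)"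
    using assms an(2) anch_nearest bag_of(1) by blast+
  with assms(3) show False
    using desc_antisym by blast
qed

text \<open>The step crosses the cut above the chunk of \<open>x\<close> and, by
  \<open>cross_up\<close>, not the next one. So \<open>y\<close> lies in the parent chunk or near
  the upper cut of another child chunk of it, and both cases give the level of the parent
  chunk.\<close>

lemma lev_cross:
  assumes "x \<in> core" "y \<in> core" "near E r x y" "\<not> desc (an x) (bag_of y)"
  shows "ring 1 x" "lev x = up (an x)" "lev y = up (an x)"
proof -
  let ?p = "up (an x)"
  obtain u where u: "an x \<noteq> a" "u \<in> far_adh (an x)" "near E r u x" "near E r u y"
    using cross[OF assms(1-3) an(1)[OF assms(1)] an(3)[OF assms(1)] assms(4)] by blast
  then show "ring 1 x"
    by (auto simp: nbhd_def)
  then show "lev x = ?p"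
    using ring_mono[where k = 1 and l = 2 and x = x] by (simp add: lev_def)
  have p: "?p \<in> N" "anch ?p = ?p" "desc ?p (bag_of y)"
    using an[OF assms(1)] u up_in up_idem cross_up[OF assms] by auto
  then have p_an: "desc ?p (an y)"
    using anch_nearest bag_of assms by blast
  show "lev y = ?p"
  proof (cases "an y = ?p")
    case True
    \<comment> \<open>Otherwise \<open>u\<close> would be within \<open>2 * r + r\<close> of the
      next cut up, against \<open>far_adh_separated\<close>.\<close>
    have "\<not> ring 2 y"
    proof
      assume "ring 2 y"
      then have "u \<in> nbhd E (far_adh ?p) (3 * r)"
        using True near_sym[OF sym_E u(4)] nbhd_trans[of y E "far_adh ?p" "2 * r" r u "3 * r"]
        by simp
      with far_adh_separated an assms u show False
        by blast
    qed
    with True show ?thesis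
      by (simp add: lev_def)
  next
    case False
    have yx: "near E r y x"
      using assms near_sym[OF sym_E] by blast
    have y: "\<not> desc (an y) (bag_of x)"
    proof
      assume "desc (an y) (bag_of x)"
      then have "desc (an y) (an x)"
        using anch_nearest bag_of an assms by blast
      moreover have "an y \<noteq> an x"
        using assms an(3)[of y] by metis
      ultimately have "desc (an y) ?p"
        using desc_up an assms u by blast
      with p_an False show False
        using desc_antisym by blast
    qed
    obtain v where v: "an y \<noteq> a" "v \<in> far_adh (an y)" "near E r v y"
      using cross[OF assms(2,1) yx an(1)[OF assms(2)] an(3)[OF assms(2)] y] by blast
    have q: "up (an y) \<in> N" "anch (up (an y)) = up (an y)" "desc (up (an y)) (bag_of x)"
      using an[OF assms(2)] v up_in up_idem cross_up[OF assms(2,1) yx y] by auto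
    \<comment> \<open>The chunk roots \<open>?p\<close> and \<open>up (an y)\<close> lie above each
      other: one comparison comes from the given step, the other from \<open>cross_up\<close>
      applied to the reversed step.\<close>
    have "desc ?p (up (an y))"
      using desc_up[of "an y" ?p] p p_an False v an assms by metis
    moreover have "desc (up (an y)) (an x)"
      using anch_nearest bag_of assms q by blast
    moreover have "up (an y) \<noteq> an x"
      using an[OF assms(2)] up_desc[of "an y"] v assms(4) by (metis desc_trans)
    ultimately have "up (an y) = ?p"
      using desc_up[of "an x" "up (an y)"] an assms u q by (metis desc_antisym)
    moreover have "ring 2 y"
      using v nbhd_mono[of y E "far_adh (an y)" r "2 * r"] by (auto simp: nbhd_def)
    ultimately show ?thesis
      by (simp add: lev_def)
  qed
qed

lemma lev_eq_different_anchors: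
  assumes "x \<in> core" "y \<in> core" "near E r x y" "an x \<noteq> an y"
  shows "lev x = lev y"
proof (cases "desc (an x) (bag_of y)")
  case True
  then show ?thesis
    using desc_disjoint_anchors[OF assms(1,2,4)] lev_cross[of y x] assms near_sym[OF sym_E]
    by metis
next
  case False
  then show ?thesis
    using lev_cross[OF assms(1-3)] by simp
qed

text \<open>This traps chains of the middle ring around one cut. Leaving upwards requires ring 1 by
  \<open>lev_cross\<close>; a point in a chunk further down would have its level at or below
  \<open>an x\<close>, whereas \<open>lev x\<close> is strictly above.\<close>

lemma outer_ring_step:
  assumes "x \<in> core" "y \<in> core" "near E r x y" "lev x = lev y" "ring 2 x" "\<not> ring 1 x"
  shows "an y = an x" "ring 2 y"
proof -
  have "far_adh (an x) \<noteq> {}"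
    using assms(5) by (auto simp: nbhd_def)
  then have "an x \<noteq> a"
    by (auto simp: far_adh_def)
  show an_eq: "an y = an x"
  proof (rule ccontr)
    assume ne: "an y \<noteq> an x"
    have "desc (an x) (bag_of y)"
      using assms lev_cross by blast
    moreover from this have "\<not> desc (an y) (bag_of x)"
      using desc_disjoint_anchors assms ne by metis
    then have "lev y = up (an y)" "an y \<noteq> a"
      using lev_cross(2)[of y x] assms near_sym[OF sym_E] desc_root bag_of by metis+
    ultimately have "desc (an x) (lev y)"
      using desc_up[of "an y" "an x"] anch_nearest[of "bag_of y" "an x"] an assms ne bag_of by metis
    then show False
      using assms up_lt[of "an x"] an \<open>an x \<noteq> a\<close> desc_le[of "an x" "lev y"] by (simp add: lev_def)
  qed
  have "lev x \<noteq> an x"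
    using assms(1,5) up_lt[of "an x"] an(1) \<open>an x \<noteq> a\<close> by (simp add: lev_def)
  with assms(4) an_eq show "ring 2 y"
    by (metis lev_def)
qed

end

section \<open>Gluing the colourings of the chunks\<close>

text \<open>Chunks are coloured at a coarser scale, at which one step covers either a step of length
  \<open>r\<close> or a whole excursion through a middle ring, of extent
  \<open>centred_bound (Suc \<eta>) r (2 * r) 0\<close>, with \<open>r\<close> more at each end for
  passing to the points whose colours are copied.\<close>

locale chunk_coloured = cut_decomp par E X N a Z \<rho> r \<eta>
  for par :: "nat \<Rightarrow> nat" and E :: "'a rel" and X N a Z \<rho> r \<eta> +
  fixes cc :: "nat \<Rightarrow> 'a \<Rightarrow> nat" and n D1 :: nat
  assumes cc_le: "cc b x \<le> n" and n_pos: "1 \<le> n"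
    and cc_bounded: "b \<in> N \<Longrightarrow> anch b = b \<Longrightarrow>
      bounded_col E (\<Union>i\<in>{i\<in>N. anch i = b}. X i) (cc b) (centred_bound (Suc \<eta>) r (2 * r) 0 + 3 * r) D1"
begin

text \<open>A point of a cut adhesion set also lies in the bag \<open>X (par (an x))\<close> of the
  parent chunk, so the parent colouring is meaningful at \<open>foot x\<close>.\<close>

definition foot :: "'a \<Rightarrow> 'a" where
  "foot x = (SOME u. u \<in> far_adh (an x) \<and> near E r u x)"

lemma foot: "ring 1 x \<Longrightarrow> foot x \<in> far_adh (an x)" "ring 1 x \<Longrightarrow> near E r (foot x) x"
  using someI_ex[of "\<lambda>u. u \<in> far_adh (an x) \<and> near E r u x"] by (auto simp: foot_def nbhd_def)

text \<open>
  Around each cut adhesion the colours of the parent chunk are copied in the inner ring; a middle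
  ring of colour 0 followed by an outer ring of colour 1 then stops every monochromatic chain.
\<close>

definition col :: "'a \<Rightarrow> nat" where
  "col x = (if ring 1 x then cc (up (an x)) (foot x)
    else if ring 2 x then 0 else if ring 3 x then 1 else cc (an x) x)"

lemma col_le: "col x \<le> n"
  using cc_le n_pos by (auto simp: col_def)

text \<open>With equal anchors, a step out of ring 2 starts outside ring 1 and ends inside ring 3,
  hence goes from colour 0 to colour 1. With different anchors the level is preserved whatever the
  colours.\<close>

lemma lev_eq:
  assumes "x \<in> core" "y \<in> core" "col x = col y" "near E r x y"
  shows "lev x = lev y"
proof (cases "an x = an y")
  case True
  have False
    if "near E r v w" "an v = an w" "col v = col w" "ring 2 v" "\<not> ring 2 w" for v w
  proof -
    have "ring 3 w"
      using that nbhd_trans[of v E "far_adh (an v)" "2 * r" r w "3 * r"] by simp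
    then have "col w = 1"
      using that ring_mono[where k = 1 and l = 2 and x = w] by (auto simp: col_def)
    moreover have "\<not> ring 1 v"
      using that nbhd_trans[of v E "far_adh (an v)" "1 * r" r w "2 * r"] by auto
    then have "col v = 0"
      using that by (simp add: col_def)
    ultimately show False
      using that by simp
  qed
  from this[of x y] this[of y x] have "ring 2 x \<longleftrightarrow> ring 2 y"
    using True assms near_sym[OF sym_E] by metis
  with True show ?thesis
    by (simp add: lev_def)
next
  case False
  then show ?thesis
    using lev_eq_different_anchors assms by blast
qed

text \<open>Without the balls around the cut above \<open>b\<close>, a point anchored at
  \<open>b\<close> is in no ring, so its colour comes from \<open>cc b\<close>. The balls are
  restored in \<open>core_bounded\<close>.\<close>

definition level_set :: "nat \<Rightarrow> 'a set" where
  "level_set b = {x \<in> core. lev x = b} - nbhd E (far_adh b) (3 * r)"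

text \<open>In a level set the bad points are those of the middle ring; the others carry the chunk
  colour of \<open>base x\<close>.\<close>

definition good :: "'a \<Rightarrow> bool" where
  "good x \<longleftrightarrow> ring 1 x \<or> \<not> ring 2 x"

definition base :: "'a \<Rightarrow> 'a" where
  "base x = (if ring 1 x then foot x else x)"

definition chunk :: "nat \<Rightarrow> 'a set" where
  "chunk b = (\<Union>i\<in>{i\<in>N. anch i = b}. X i)"

definition outer :: "nat \<Rightarrow> 'a set" where
  "outer q = {x. an x = q \<and> ring 2 x}"

abbreviation D0 :: nat where "D0 \<equiv> centred_bound (Suc \<eta>) r (2 * r) 0"

text \<open>At most \<open>\<eta> + 1\<close> balls cover the whole set, so
  \<open>bounded_col_nbhd\<close> applies with nothing left outside them, whatever the
  colours.\<close>

lemma outer_bounded: "q \<in> N \<Longrightarrow> bounded_col E (outer q) col r D0"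
proof (rule bounded_col_nbhd[OF sym_E])
  have empty: "outer q - nbhd E (far_adh q) (2 * r) = {}"
    by (auto simp: outer_def)
  show "bounded_col E (outer q - nbhd E (far_adh q) (2 * r)) col r 0"
    unfolding empty by (simp add: bounded_col_def mono_step_def)
qed (use far_adh_finite_card in auto)

lemma base_near: "near E r (base x) x"
  using foot(2) by (simp add: base_def)

text \<open>In ring 1 the level is the parent chunk, whose colouring is copied; outside ring 2 the
  anchor is \<open>b\<close> itself, and the removed balls exclude ring 3.\<close>

lemma base_good:
  assumes "x \<in> level_set b" "good x"
  shows "base x \<in> chunk b" "cc b (base x) = col x"
proof -
  have x: "x \<in> core" "lev x = b" "x \<notin> nbhd E (far_adh b) (3 * r)"
    using assms by (auto simp: level_set_def)
  have "base x \<in> chunk b \<and> cc b (base x) = col x"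
  proof (cases "ring 1 x")
    case True
    then have "lev x = up (an x)"
      using ring_mono[where k = 1 and l = 2 and x = x] by (simp add: lev_def)
    moreover have "foot x \<in> far_adh (an x)"
      using True by (rule foot)
    then have "an x \<noteq> a" "foot x \<in> X (par (an x))"
      by (auto simp: far_adh_def split: if_splits)
    moreover have "par (an x) \<in> N"
      using \<open>an x \<noteq> a\<close> an(1)[OF x(1)] by (rule par_in[rotated])
    ultimately show ?thesis
      using True x by (auto simp: chunk_def base_def col_def)
  next
    case False
    with assms have "\<not> ring 2 x"
      by (simp add: good_def)
    with x have "an x = b"
      by (simp add: lev_def)
    then show ?thesis
      using False \<open>\<not> ring 2 x\<close> x bag_of[OF x(1)] by (auto simp: chunk_def base_def col_def)
  qed
  then show "base x \<in> chunk b" "cc b (base x) = col x"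
    by auto
qed

lemma bad_step:
  assumes "(x, y) \<in> mono_step E (level_set b) col r" "\<not> good x"
  shows "an y = an x" "x \<in> outer (an x)" "(x, y) \<in> mono_step E (outer (an x)) col r"
proof -
  have xy: "x \<in> core" "y \<in> core" "lev x = lev y" "near E r x y" "col x = col y"
    using assms by (auto simp: mono_step_def level_set_def)
  have x: "ring 2 x" "\<not> ring 1 x"
    using assms(2) by (auto simp: good_def)
  show "an y = an x"
    using outer_ring_step[OF xy(1,2,4,3) x] by simp
  show "x \<in> outer (an x)"
    using x by (simp add: outer_def)
  then show "(x, y) \<in> mono_step E (outer (an x)) col r"
    using outer_ring_step[OF xy(1,2,4,3) x] xy by (simp add: outer_def mono_step_def)
qed

lemma mono_step_sym: "(x, y) \<in> mono_step E Y c k \<Longrightarrow> (y, x) \<in> mono_step E Y c k"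
  using near_sym[OF sym_E] by (auto simp: mono_step_def)

abbreviation base_chain :: "nat \<Rightarrow> 'a \<Rightarrow> 'a \<Rightarrow> bool" where
  "base_chain b x z \<equiv> (base x, base z) \<in> (mono_step E (chunk b) (cc b) (D0 + 3 * r))\<^sup>*"

lemma base_chain_step:
  assumes "base_chain b x z" "z \<in> level_set b" "good z" "y \<in> level_set b" "good y"
    and "col z = col y" "near E (D0 + r) z y"
  shows "base_chain b x y"
proof -
  have "near E (r + (D0 + r) + r) (base z) (base y)"
    by (rule near_trans[OF near_trans[OF base_near assms(7)] near_sym[OF sym_E base_near]])
  then have "near E (D0 + 3 * r) (base z) (base y)"
    by (rule near_mono) simp
  with assms(2-6) have "(base z, base y) \<in> mono_step E (chunk b) (cc b) (D0 + 3 * r)"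
    using base_good[of z b] base_good[of y b] by (simp add: mono_step_def)
  with assms(1) show ?thesis
    by (rule rtrancl_into_rtrancl)
qed

text \<open>Induction invariant: at a good point, the base points are linked inside the chunk;
  during an excursion, \<open>z\<close> is the last good point before it, and the excursion stays
  around the one cut of \<open>an y\<close>. When it ends, \<open>z\<close> and the new point have
  equal colours and distance at most \<open>D0\<close>, which makes one step of the coarser
  chain.\<close>

lemma chain_from_good:
  assumes "(x, y) \<in> (mono_step E (level_set b) col r)\<^sup>*" "x \<in> level_set b" "good x"
  shows "(good y \<and> base_chain b x y) \<or>
    (\<not> good y \<and> (\<exists>z. good z \<and> z \<in> level_set b \<and> z \<in> outer (an y) \<and> col z = col y \<and>
      base_chain b x z \<and> (z, y) \<in> (mono_step E (outer (an y)) col r)\<^sup>*))"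
  using assms(1)
proof induction
  case base
  with assms show ?case by simp
next
  case (step y y')
  have yy: "y \<in> level_set b" "y' \<in> level_set b" "col y = col y'" "near E r y y'"
    using step.hyps by (auto simp: mono_step_def)
  show ?case
  proof (cases "good y")
    case True
    with step.IH have chain: "base_chain b x y"
      by simp
    show ?thesis
    proof (cases "good y'")
      case True
      then show ?thesis
        using base_chain_step[OF chain yy(1) \<open>good y\<close> yy(2) True yy(3)] near_mono[OF yy(4)] by simp
    next
      case False
      note bad = bad_step[OF mono_step_sym[OF step.hyps(2)] False]
      then have "(y, y') \<in> mono_step E (outer (an y')) col r"
        by (blast intro: mono_step_sym)
      moreover from this have "y \<in> outer (an y')"
        by (simp add: mono_step_def)
      ultimately show ?thesis
        using False True chain yy by blast
    qed
  next
    case False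
    note bad = bad_step[OF step.hyps(2) False]
    from step.IH False obtain z where z: "good z" "z \<in> level_set b" "z \<in> outer (an y)"
        "col z = col y" "base_chain b x z" "(z, y) \<in> (mono_step E (outer (an y)) col r)\<^sup>*"
      by blast
    have zy': "(z, y') \<in> (mono_step E (outer (an y)) col r)\<^sup>*"
      using z(6) bad(3) by (rule rtrancl_into_rtrancl)
    show ?thesis
    proof (cases "good y'")
      case True
      have "an y \<in> N"
        using yy(1) by (auto simp: level_set_def intro: an)
      then have "near E D0 z y'"
        using zy' by (blast intro: bounded_colD outer_bounded)
      then have "near E (D0 + r) z y'"
        by (rule near_mono) simp
      then show ?thesis
        using base_chain_step[OF z(5,2,1) yy(2) True] z yy True by simp
    next
      case False
      then show ?thesis
        using z zy' bad(1) yy by auto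
    qed
  qed
qed

lemma near_from_good:
  assumes "(x, y) \<in> (mono_step E (level_set b) col r)\<^sup>*" "x \<in> level_set b" "good x" "y \<in> level_set b"
    and "b \<in> N" "anch b = b"
  shows "near E (D0 + D1 + 2 * r) x y"
proof -
  have chain_near: "near E (r + D1 + r) x z" if "base_chain b x z" for z
  proof -
    have "near E D1 (base x) (base z)"
      using cc_bounded[OF assms(5,6)] that unfolding chunk_def by (rule bounded_colD)
    then show ?thesis
      by (rule near_trans[OF near_trans[OF near_sym[OF sym_E base_near]] base_near])
  qed
  from chain_from_good[OF assms(1-3)] show ?thesis
  proof (elim disjE conjE exE)
    assume "base_chain b x y"
    from chain_near[OF this] show ?thesis
      by (rule near_mono) simp
  next
    fix z
    assume z: "base_chain b x z" "(z, y) \<in> (mono_step E (outer (an y)) col r)\<^sup>*"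
    have "an y \<in> N"
      using assms(4) by (auto simp: level_set_def intro: an)
    then have "near E D0 z y"
      using z(2) by (blast intro: bounded_colD outer_bounded)
    from near_trans[OF chain_near[OF z(1)] this] show ?thesis
      by (rule near_mono) simp
  qed
qed

text \<open>Either the chain passes a good point, from which \<open>near_from_good\<close> reaches
  both ends, or it is caught around a single cut.\<close>

lemma chain_from_bad:
  assumes "(x, y) \<in> (mono_step E (level_set b) col r)\<^sup>*" "x \<in> level_set b"
  shows "y \<in> level_set b \<and>
    ((\<exists>z\<in>level_set b. good z \<and> (x, z) \<in> (mono_step E (level_set b) col r)\<^sup>* \<and>
        (z, y) \<in> (mono_step E (level_set b) col r)\<^sup>*) \<or>
     (an y = an x \<and> (x, y) \<in> (mono_step E (outer (an x)) col r)\<^sup>*))"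
  using assms(1)
proof induction
  case base
  with assms show ?case by simp
next
  case (step y y')
  have yy: "y \<in> level_set b" "y' \<in> level_set b"
    using step.hyps by (auto simp: mono_step_def)
  show ?case
  proof (cases "good y")
    case True
    then show ?thesis
      using step.hyps yy by blast
  next
    case False
    note bad = bad_step[OF step.hyps(2) False]
    show ?thesis
      using step.IH
    proof (elim disjE conjE bexE)
      assume "an y = an x" "(x, y) \<in> (mono_step E (outer (an x)) col r)\<^sup>*"
      with bad have "an y' = an x" "(x, y') \<in> (mono_step E (outer (an x)) col r)\<^sup>*"
        by (auto intro: rtrancl_into_rtrancl)
      with yy show ?thesis
        by blast
    next
      fix z
      assume "z \<in> level_set b" "good z" "(x, z) \<in> (mono_step E (level_set b) col r)\<^sup>*"
        "(z, y) \<in> (mono_step E (level_set b) col r)\<^sup>*"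
      with step.hyps(2) yy show ?thesis
        by (blast intro: rtrancl_into_rtrancl)
    qed
  qed
qed

lemma level_set_bounded:
  assumes "b \<in> N" "anch b = b"
  shows "bounded_col E (level_set b) col r (2 * (D0 + D1 + 2 * r))"
  unfolding bounded_col_def
proof (intro allI impI)
  fix x y assume xy: "(x, y) \<in> (mono_step E (level_set b) col r)\<^sup>*"
  show "near E (2 * (D0 + D1 + 2 * r)) x y"
  proof (cases "x \<in> level_set b")
    case False
    with xy have "x = y"
      by (auto simp: mono_step_def elim: converse_rtranclE)
    then show ?thesis
      by simp
  next
    case True
    from chain_from_bad[OF xy this] show ?thesis
    proof (elim disjE conjE bexE)
      assume "(x, y) \<in> (mono_step E (outer (an x)) col r)\<^sup>*"
      moreover have "an x \<in> N"
        using True by (auto simp: level_set_def intro: an)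
      ultimately have "near E D0 x y"
        by (blast intro: bounded_colD outer_bounded)
      then show ?thesis
        by (rule near_mono) simp
    next
      fix z
      assume z: "y \<in> level_set b" "z \<in> level_set b" "good z"
        "(x, z) \<in> (mono_step E (level_set b) col r)\<^sup>*" "(z, y) \<in> (mono_step E (level_set b) col r)\<^sup>*"
      then have zx: "(z, x) \<in> (mono_step E (level_set b) col r)\<^sup>*"
        using sym_mono_step[OF sym_E] by (meson symD)
      show ?thesis
        using near_trans[OF near_sym[OF sym_E near_from_good[OF zx z(2,3) True assms]]
            near_from_good[OF z(5,2,3,1) assms]]
        unfolding mult_2[of "D0 + D1 + 2 * r"] .
    qed
  qed
qed

lemma lev_in:
  assumes "x \<in> core" shows "lev x \<in> N" "anch (lev x) = lev x"
proof -
  have "an x \<noteq> a" if "ring 2 x"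
    using that by (auto simp: nbhd_def far_adh_def)
  then show "lev x \<in> N" "anch (lev x) = lev x"
    using an[OF assms] up_in up_idem by (auto simp: lev_def)
qed

text \<open>The number of cuts is unbounded, so the balls around them are restored level by level:
  each level only misses those around its own at most \<open>\<eta> + 1\<close> centres.\<close>

lemma core_bounded:
  "bounded_col E core col r (centred_bound (Suc \<eta>) r (3 * r) (2 * (D0 + D1 + 2 * r)))"
proof (rule bounded_col_partition[where l = lev])
  fix b
  show "bounded_col E {x \<in> core. lev x = b} col r
    (centred_bound (Suc \<eta>) r (3 * r) (2 * (D0 + D1 + 2 * r)))"
  proof (cases "b \<in> N \<and> anch b = b")
    case True
    then show ?thesis
      using bounded_col_nbhd[OF sym_E, of "far_adh b" "Suc \<eta>" _ "3 * r"]
        far_adh_finite_card level_set_bounded unfolding level_set_def by blast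
  next
    case False
    then have empty: "{x \<in> core. lev x = b} = {}"
      using lev_in by blast
    show ?thesis
      unfolding empty by (simp add: bounded_col_def mono_step_def)
  qed
qed (rule lev_eq)

lemma col_bounded:
  assumes "finite Z" "card Z \<le> k"
  shows "bounded_col E (\<Union>i\<in>N. X i) col r (centred_bound k r (\<rho> + r)
    (centred_bound (Suc \<eta>) r (3 * r) (2 * (D0 + D1 + 2 * r))))"
  using bounded_col_nbhd[OF sym_E assms] core_bounded unfolding core_def by blast

end

text \<open>\<open>D\<close> is chosen before the graph, the tree and the centres, hence uniformly.
  The induction generalises \<open>r\<close>, \<open>k\<close> and \<open>\<rho>\<close>, since
  chunks are coloured at a coarser scale with more centres and larger balls; for the same reason the
  bags are assumed colourable at every scale.\<close>

lemma colouring_adhesions_partly_covered: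
  fixes Db :: "nat \<Rightarrow> nat"
  assumes "1 \<le> n"
  shows "\<exists>D. \<forall>(E :: 'a rel) X par N a Z.
    rooted_decomp par E X N a \<longrightarrow> finite Z \<longrightarrow> card Z \<le> k \<longrightarrow>
    (\<forall>i\<in>N. i \<noteq> a \<longrightarrow> finite (X i \<inter> X (par i)) \<and> card (X i \<inter> X (par i) - nbhd E Z \<rho>) \<le> \<eta>) \<longrightarrow>
    (\<forall>i\<in>N. \<forall>r. \<exists>c. (\<forall>x. c x \<le> n) \<and> bounded_col E (X i) c r (Db r)) \<longrightarrow>
    (\<exists>c. (\<forall>x. c x \<le> n) \<and> bounded_col E (\<Union>i\<in>N. X i) c r D)"
proof (induction \<eta> arbitrary: r k \<rho>)
  case 0
  show ?case
  proof (intro exI[of _ "centred_bound k r (\<rho> + r) (Db r)"] allI impI)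
    fix E :: "'a rel" and X par N a Z
    assume "rooted_decomp par E X N a" "finite Z" "card Z \<le> k"
      and adh: "\<forall>i\<in>N. i \<noteq> a \<longrightarrow> finite (X i \<inter> X (par i)) \<and>
        card (X i \<inter> X (par i) - nbhd E Z \<rho>) \<le> 0"
      and bags: "\<forall>i\<in>N. \<forall>r. \<exists>c. (\<forall>x. c x \<le> n) \<and> bounded_col E (X i) c r (Db r)"
    then show "\<exists>c. (\<forall>x. c x \<le> n) \<and>
        bounded_col E (\<Union>i\<in>N. X i) c r (centred_bound k r (\<rho> + r) (Db r))"
    proof (intro colouring_adhesions_covered[of par E X N a Z k \<rho> n r])
      fix i assume "i \<in> N" "i \<noteq> a"
      with adh show "X i \<inter> X (par i) \<subseteq> nbhd E Z \<rho>"
        by fastforce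
    qed blast+
  qed
next
  case (Suc \<eta>)
  define R where "R = centred_bound (Suc \<eta>) r (2 * r) 0 + 3 * r"
  from Suc.IH[where k = "k + Suc \<eta>" and \<rho> = "\<rho> + 3 * r" and r = R]
  obtain D1 where "\<forall>(E :: 'a rel) X par N a Z.
    rooted_decomp par E X N a \<longrightarrow> finite Z \<longrightarrow> card Z \<le> k + Suc \<eta> \<longrightarrow>
    (\<forall>i\<in>N. i \<noteq> a \<longrightarrow> finite (X i \<inter> X (par i)) \<and>
      card (X i \<inter> X (par i) - nbhd E Z (\<rho> + 3 * r)) \<le> \<eta>) \<longrightarrow>
    (\<forall>i\<in>N. \<forall>r. \<exists>c. (\<forall>x. c x \<le> n) \<and> bounded_col E (X i) c r (Db r)) \<longrightarrow>
    (\<exists>c. (\<forall>x. c x \<le> n) \<and> bounded_col E (\<Union>i\<in>N. X i) c R D1)" ..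
  note D1 = this[rule_format]
  define D2 where "D2 = centred_bound k r (\<rho> + r) (centred_bound (Suc \<eta>) r (3 * r)
    (2 * (centred_bound (Suc \<eta>) r (2 * r) 0 + D1 + 2 * r)))"
  show ?case
  proof (intro exI[of _ D2] allI impI)
    fix E :: "'a rel" and X par N a Z
    assume decomp: "rooted_decomp par E X N a" and Z: "finite Z" "card Z \<le> k"
      and adh: "\<forall>i\<in>N. i \<noteq> a \<longrightarrow> finite (X i \<inter> X (par i)) \<and>
        card (X i \<inter> X (par i) - nbhd E Z \<rho>) \<le> Suc \<eta>"
      and bags: "\<forall>i\<in>N. \<forall>r. \<exists>c. (\<forall>x. c x \<le> n) \<and> bounded_col E (X i) c r (Db r)"
    interpret rooted_decomp par E X N a by fact
    interpret cut_decomp par E X N a Z \<rho> r \<eta>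
      using adh by unfold_locales auto
    have "\<exists>c. (\<forall>x. c x \<le> n) \<and> bounded_col E (\<Union>i\<in>{i\<in>N. anch i = b}. X i) c R D1"
      if b: "b \<in> N" "anch b = b" for b
    proof (rule D1[of par E X _ b "Z \<union> far_adh b"])
      show "rooted_decomp par E X {i\<in>N. anch i = b} b"
      proof unfold_locales
        fix i assume i: "i \<in> {i\<in>N. anch i = b}"
        then show "desc b i"
          using anch_desc[of i] by auto
        assume "i \<noteq> b"
        then have "i \<noteq> a"
          using i b anch_root by force
        have "i \<in> N" "b = anch i"
          using i by auto
        with \<open>i \<noteq> b\<close> \<open>i \<noteq> a\<close> have "anch (par i) = b"
          using anch_eq[of i] by presburger
        with i \<open>i \<noteq> a\<close> show "par i \<in> {i\<in>N. anch i = b}"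
          using par_in[of i] by simp
      next
        fix i s s' x y l
        assume i: "i \<in> {i\<in>N. anch i = b}" "i \<noteq> b"
          and s: "s \<in> {i\<in>N. anch i = b}" "s' \<in> {i\<in>N. anch i = b}" "desc i s" "\<not> desc i s'"
          and xy: "x \<in> X s" "y \<in> X s'" "near E l x y"
        have "i \<noteq> a"
          using i b anch_root by force
        then show "\<exists>u\<in>X i \<inter> X (par i). near E l x u \<and> near E l u y"
          using separation[of i s s' x y l] i s xy by blast
      qed (use b sym_E in auto)
      show "finite (Z \<union> far_adh b)" "card (Z \<union> far_adh b) \<le> k + Suc \<eta>"
        using Z far_adh_finite_card[OF b(1)] card_Un_le[of Z "far_adh b"] by auto
      fix i assume i: "i \<in> {i\<in>N. anch i = b}" "i \<noteq> b"
      then have "i \<noteq> a"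
        using b anch_root by force
      \<comment> \<open>A node other than the chunk root has the anchor \<open>b\<close> of its
        parent, so it was not cut; this is the bound \<open>\<eta>\<close>.\<close>
      moreover from this have "\<not> cut b i"
        using i anch_eq[of i] by (metis (mono_tags, lifting) mem_Collect_eq)
      ultimately show "finite (X i \<inter> X (par i)) \<and>
        card (X i \<inter> X (par i) - nbhd E (Z \<union> far_adh b) (\<rho> + 3 * r)) \<le> \<eta>"
        using adh i by (auto simp: cut_def)
    qed (use bags in blast)
    then have "\<forall>b. \<exists>c. b \<in> N \<longrightarrow> anch b = b \<longrightarrow>
        (\<forall>x. c x \<le> n) \<and> bounded_col E (\<Union>i\<in>{i\<in>N. anch i = b}. X i) c R D1"
      by blast
    from choice[OF this] obtain cc where cc: "\<And>b. b \<in> N \<Longrightarrow> anch b = b \<Longrightarrow>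
        (\<forall>x. cc b x \<le> n) \<and> bounded_col E (\<Union>i\<in>{i\<in>N. anch i = b}. X i) (cc b) R D1"
      by blast
    \<comment> \<open>\<open>chunk_coloured\<close> bounds the colours for every index, so the
      colouring is constantly 0 off the chunk roots.\<close>
    define cc' where "cc' b = (if b \<in> N \<and> anch b = b then cc b else (\<lambda>_. 0))" for b
    interpret chunk_coloured par E X N a Z \<rho> r \<eta> cc' n D1
    proof unfold_locales
      show "cc' b x \<le> n" for b x
        using cc by (simp add: cc'_def)
      show "1 \<le> n"
        by fact
      fix b assume b: "b \<in> N" "anch b = b"
      then have "cc' b = cc b"
        by (simp add: cc'_def)
      with cc[OF b] show "bounded_col E (\<Union>i\<in>{i\<in>N. anch i = b}. X i) (cc' b)
          (centred_bound (Suc \<eta>) r (2 * r) 0 + 3 * r) D1"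
        unfolding R_def by simp
    qed
    show "\<exists>c. (\<forall>x. c x \<le> n) \<and> bounded_col E (\<Union>i\<in>N. X i) c r D2"
      using col_le col_bounded[OF Z] unfolding D2_def by blast
  qed
qed

section \<open>Numbering the nodes of a tree\<close>

lemma (in pair_wf_digraph) awalk_of_relpow:
  "(x, y) \<in> parcs G ^^ k \<Longrightarrow> x \<in> pverts G \<Longrightarrow> \<exists>p. awalk x p y \<and> length p = k"
proof (induction k arbitrary: x)
  case 0
  then show ?case by (auto simp: awalk_Nil_iff)
next
  case (Suc k)
  then obtain z where z: "(x, z) \<in> parcs G" "(z, y) \<in> parcs G ^^ k"
    by (meson relpow_Suc_D2)
  with Suc.IH[of z] obtain p where "awalk z p y" "length p = k"
    using in_arcsD2 by blast
  with z(1) Suc.prems have "awalk x ((x, z) # p) y" "length ((x, z) # p) = Suc k"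
    by (auto simp: awalk_Cons_iff)
  then show ?case
    by blast
qed

lemma (in pair_wf_digraph) relpow_of_awalk: "awalk x p y \<Longrightarrow> (x, y) \<in> parcs G ^^ length p"
proof (induction p arbitrary: x)
  case (Cons e p)
  then have "(x, snd e) \<in> parcs G" "(snd e, y) \<in> parcs G ^^ length p"
    by (auto simp: awalk_Cons_iff)
  then have "(x, y) \<in> parcs G ^^ Suc (length p)"
    by (rule relpow_Suc_I2)
  then show ?case
    by simp
qed (simp add: awalk_Nil_iff)

lemma (in pair_wf_digraph) ex_short_apath:
  assumes "awalk x p y"
  shows "\<exists>q. apath x q y \<and> length q \<le> length p"
  using assms
proof (induction p rule: awalk_to_apath_induct)
  case (path p)
  then show ?case
    by (auto simp: apath_def)
next
  case (decomp p q r s)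
  then have "p = q @ r @ s"
    by (auto elim: awalk_cyc_decompE)
  then have "length (q @ s) \<le> length p"
    by simp
  with decomp(4) show ?case
    by (meson le_trans)
qed

text \<open>Every walk contains a path that is no longer, so path distance agrees with
  \<open>near\<close>. The point \<open>x\<close> must be a vertex because \<open>near\<close> is
  reflexive everywhere.\<close>

lemma gdist_le_iff:
  assumes "pair_graph G" "x \<in> pverts G"
  shows "gdist G x y \<le> enat k \<longleftrightarrow> near (parcs G) k x y"
proof -
  interpret pair_graph G by fact
  show ?thesis
  proof
    assume "gdist G x y \<le> enat k"
    \<comment> \<open>The strict inequality lets \<open>INF_less_iff\<close> extract an actual
      path.\<close>
    then have "gdist G x y < enat (Suc k)"
      by (metis enat_ord_simps(2) lessI order_le_less_trans)
    then obtain p where "apath x p y" "length p < Suc k"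
      unfolding gdist_def by (auto simp: INF_less_iff)
    then show "near (parcs G) k x y"
      unfolding near_def by (auto simp: apath_def dest: relpow_of_awalk intro!: exI[of _ "length p"])
  next
    assume "near (parcs G) k x y"
    then obtain j where "j \<le> k" "(x, y) \<in> parcs G ^^ j"
      by (auto simp: near_def)
    moreover from this obtain p where "awalk x p y" "length p = j"
      using awalk_of_relpow assms(2) by blast
    ultimately obtain p where "apath x p y" "length p \<le> k"
      using ex_short_apath by fastforce
    then show "gdist G x y \<le> enat k"
      unfolding gdist_def by (intro INF_lower2[of p]) auto
  qed
qed

section \<open>Growing a numbered subtree node by node\<close>

lemma connected_crossing_arc:
  assumes "Digraph_Component.connected (with_proj H)" "sym (parcs H)"
    and "u \<in> pverts H" "v \<in> pverts H" "u \<in> A" "v \<notin> A"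
  obtains p q where "(p, q) \<in> parcs H" "p \<in> A" "q \<notin> A"
proof -
  have "parcs (mk_symmetric (with_proj H)) \<subseteq> parcs H"
    using assms(2) by (auto simp: mk_symmetric_def dest: symD)
  moreover have "(u, v) \<in> rtrancl_on (pverts H) (parcs (mk_symmetric (with_proj H)))"
    using assms(1,3,4) unfolding connected_def strongly_connected_def reachable_def
    by (simp add: mk_symmetric_def)
  ultimately have "(u, v) \<in> (parcs H)\<^sup>*"
    by (meson rtrancl_mono rtrancl_on_rtranclI subsetD)
  then have "\<exists>p q. (p, q) \<in> parcs H \<and> p \<in> A \<and> q \<notin> A"
    using assms(5,6)
  proof (induction rule: rtrancl_induct)
    case (step y z)
    then show ?case by (cases "y \<in> A") auto
  qed simp
  with that show thesis by blast
qed

text \<open>A path inside \<open>S\<close> between two different neighbours of \<open>v\<close> has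
  at least one arc and closes through \<open>v\<close> to a cycle of length at least 3.\<close>

lemma tree_unique_neighbour:
  assumes "is_tree T" "v \<notin> S" "S \<subseteq> pverts T"
    and "(p, q) \<in> (parcs T \<inter> S \<times> S)\<^sup>*" "p \<in> S" "(p, v) \<in> parcs T" "(q, v) \<in> parcs T"
  shows "p = q"
proof (rule ccontr)
  assume "p \<noteq> q"
  interpret pair_graph T
    using assms(1) by (simp add: is_tree_def)
  interpret S: pair_wf_digraph "induced T S"
    by unfold_locales (auto simp: induced_def)
  obtain k where "(p, q) \<in> parcs (induced T S) ^^ k"
    using assms(4) rtrancl_imp_relpow by (fastforce simp: induced_def)
  then obtain w where w: "S.apath p w q"
    using S.awalk_of_relpow[of p q k] assms(5) S.ex_short_apath by (fastforce simp: induced_def)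
  then have arcs: "set w \<subseteq> parcs T" "pcas p w q" "distinct (pawalk_verts p w)"
    unfolding S.apath_def S.awalk_def by (auto simp: induced_def)
  have "set (pawalk_verts p w) \<subseteq> S"
    using w S.awalk_verts_in_verts[of p w] unfolding S.apath_def S.awalk_def
    by (auto simp: induced_def)
  moreover have "w \<noteq> []"
    using arcs(2) \<open>p \<noteq> q\<close> by auto
  moreover have vp: "(v, p) \<in> parcs T"
    using assms(6) pair_sym_arcs by (auto simp: symmetric_def dest: symD)
  define c where "c = (v, p) # w @ [(q, v)]"
  have verts: "pawalk_verts x (w @ [(q, v)]) = pawalk_verts x w @ [v]" if "pcas x w q" for x
    using that by (induction w arbitrary: x) auto
  have last: "last (pawalk_verts x w) = q" if "pcas x w q" for x
    using that by (induction w arbitrary: x) auto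
  have "awalk v c v"
    using arcs vp last[OF arcs(2)] assms(7) in_arcsD1[OF vp] by (auto simp: awalk_def c_def)
  moreover have "tl (pawalk_verts v c) = pawalk_verts p w @ [v]"
    using verts[OF arcs(2)] by (simp add: c_def)
  ultimately have "cycle c" "3 \<le> length c"
    using arcs(3) assms(2) by (auto simp: cycle_def c_def Suc_le_eq)
  then show False
    using assms(1) by (auto simp: is_tree_def)
qed

definition tree_numbering :: "'t ugraph \<Rightarrow> (nat \<Rightarrow> nat) \<Rightarrow> (nat \<Rightarrow> 't) \<Rightarrow> nat \<Rightarrow> bool" where
  "tree_numbering T par nd m \<longleftrightarrow> par_tree par \<and> 0 < m \<and> inj_on nd {..<m} \<and> nd ` {..<m} \<subseteq> pverts T \<and>
    (\<forall>i<m. i \<noteq> 0 \<longrightarrow> (nd i, nd (par i)) \<in> parcs T) \<and>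
    (\<forall>i<m. \<forall>j<m. (nd i, nd j) \<in> parcs T \<longrightarrow> i \<noteq> 0 \<and> j = par i \<or> j \<noteq> 0 \<and> i = par j)"

text \<open>Connectedness gives a node \<open>v\<close> outside the numbered part with a neighbour
  in it. Acyclicity makes this neighbour unique; it becomes the parent, so every arc between
  numbered nodes remains a parent arc.\<close>

lemma tree_numbering_Suc:
  assumes tree: "is_tree T" and num: "tree_numbering T par nd m" and "m < card (pverts T)"
  shows "\<exists>par nd. tree_numbering T par nd (Suc m)"
proof -
  interpret pair_graph T
    using tree by (simp add: is_tree_def)
  interpret par_tree par
    using num by (simp add: tree_numbering_def)
  have sym_T: "sym (parcs T)"
    using pair_sym_arcs by (simp add: symmetric_def)
  define S where "S = nd ` {..<m}"
  have m: "0 < m" "inj_on nd {..<m}" "S \<subseteq> pverts T"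
    and par_arc: "\<And>i. i < m \<Longrightarrow> i \<noteq> 0 \<Longrightarrow> (nd i, nd (par i)) \<in> parcs T"
    and arc_par: "\<And>i j. i < m \<Longrightarrow> j < m \<Longrightarrow> (nd i, nd j) \<in> parcs T \<Longrightarrow>
      i \<noteq> 0 \<and> j = par i \<or> j \<noteq> 0 \<and> i = par j"
    using num by (auto simp: tree_numbering_def S_def)
  have "card S = m"
    using m by (simp add: S_def card_image)
  then obtain v0 where "v0 \<in> pverts T" "v0 \<notin> S"
    using assms(3) m by (metis card_mono finite_imageI finite_lessThan S_def leD subsetI)
  moreover have "nd 0 \<in> S"
    using m by (auto simp: S_def)
  ultimately obtain u v where uv: "(u, v) \<in> parcs T" "u \<in> S" "v \<notin> S"
    using connected_crossing_arc[of T "nd 0" v0 S] tree sym_T m by (auto simp: is_tree_def)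
  then obtain p where p: "p < m" "u = nd p"
    by (auto simp: S_def)
  have to_root: "(nd i, nd 0) \<in> (parcs T \<inter> S \<times> S)\<^sup>*" if "i < m" for i
    using that
  proof (induction i rule: less_induct)
    case (less i)
    show ?case
    proof (cases "i = 0")
      case False
      then have "par i < i"
        by (simp add: par_less)
      with less False have "(nd i, nd (par i)) \<in> parcs T \<inter> S \<times> S" "(nd (par i), nd 0) \<in> (parcs T \<inter> S \<times> S)\<^sup>*"
        using par_arc by (auto simp: S_def)
      then show ?thesis
        by (rule converse_rtrancl_into_rtrancl)
    qed simp
  qed
  have "sym ((parcs T \<inter> S \<times> S)\<^sup>*)"
    using sym_T by (intro sym_rtrancl) (auto simp: sym_def)
  then have linked: "(nd i, nd j) \<in> (parcs T \<inter> S \<times> S)\<^sup>*" if "i < m" "j < m" for i j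
    using to_root[OF that(1)] to_root[OF that(2)] by (meson rtrancl_trans symD)
  have unique: "j = p" if "j < m" "(nd j, v) \<in> parcs T" for j
  proof -
    have "nd j = nd p"
      using tree_unique_neighbour[OF tree uv(3) m(3) linked[OF that(1) p(1)]] that uv p
      by (auto simp: S_def)
    with m(2) that p show ?thesis
      by (auto dest: inj_onD)
  qed
  define nd' where "nd' = nd(m := v)"
  define par' where "par' = par(m := p)"
  have "par_tree par'"
    using par_0 par_less p m by unfold_locales (auto simp: par'_def)
  moreover have "nd' i = nd i" "par' i = par i" if "i < m" for i
    using that by (auto simp: nd'_def par'_def)
  note old = this
  have new: "nd' m = v" "par' m = p"
    by (auto simp: nd'_def par'_def)
  have "inj_on nd' {..<Suc m}"
    using m(2) uv(3) by (auto simp: nd'_def inj_on_def S_def lessThan_Suc)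
  moreover have "nd' ` {..<Suc m} \<subseteq> pverts T"
    using m(3) in_arcsD2[OF uv(1)] by (auto simp: S_def old new lessThan_Suc)
  moreover have "(nd' i, nd' (par' i)) \<in> parcs T" if "i < Suc m" "i \<noteq> 0" for i
  proof (cases "i = m")
    case True
    then show ?thesis
      using uv(1) p old new symD[OF sym_T] by auto
  next
    case False
    with that have "i < m" "par i < m"
      using par_less[of i] by auto
    with that show ?thesis
      using par_arc old by simp
  qed
  moreover have "i \<noteq> 0 \<and> j = par' i \<or> j \<noteq> 0 \<and> i = par' j"
    if ij: "i < Suc m" "j < Suc m" "(nd' i, nd' j) \<in> parcs T" for i j
  proof -
    consider "i = m" "j = m" | "i = m" "j < m" | "i < m" "j = m" | "i < m" "j < m"
      using ij by linarith
    then show ?thesis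
    proof cases
      case 1
      then show ?thesis
        using ij pair_no_loops by fastforce
    next
      case 2
      then have "j = p"
        using ij old new symD[OF sym_T] by (intro unique) auto
      with 2 m show ?thesis
        by (simp add: new)
    next
      case 3
      then have "i = p"
        using ij old new by (intro unique) auto
      with 3 m show ?thesis
        by (simp add: new)
    next
      case 4
      then show ?thesis
        using arc_par[of i j] ij old by simp
    qed
  qed
  ultimately show ?thesis
    unfolding tree_numbering_def using m(1) by (intro exI[of _ par'] exI[of _ nd']) auto
qed

lemma tree_numbering_exists:
  assumes "is_tree T"
  obtains par nd where "tree_numbering T par nd (card (pverts T))"
proof -
  interpret pair_graph T
    using assms by (simp add: is_tree_def)
  obtain t where t: "t \<in> pverts T"
    using assms by (auto simp: is_tree_def connected_def strongly_connected_def mk_symmetric_def)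
  have "\<exists>par nd. tree_numbering T par nd m" if "0 < m" "m \<le> card (pverts T)" for m
    using that
  proof (induction m)
    case (Suc m)
    show ?case
    proof (cases m)
      case 0
      have "tree_numbering T (\<lambda>_. 0) (\<lambda>_. t) 1"
        using t pair_no_loops[of "(t, t)"] by (auto simp: tree_numbering_def par_tree_def inj_on_def)
      with 0 show ?thesis
        by auto
    next
      case (Suc k)
      with Suc.IH Suc.prems obtain par nd where "tree_numbering T par nd m"
        by auto
      then show ?thesis
        using tree_numbering_Suc[OF assms] Suc.prems by simp
    qed
  qed simp
  from this[of "card (pverts T)"] that show thesis
    using t pair_finite_verts by (auto simp: card_gt_0_iff)
qed

section \<open>Colourings of the bags\<close>

text \<open>The clause \<open>in_adhesion\<close> encodes that the nodes whose bags contain a given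
  vertex are connected in the tree.\<close>

locale numbered_decomp = par_tree par for par :: "nat \<Rightarrow> nat" +
  fixes G :: "'a ugraph" and X :: "nat \<Rightarrow> 'a set" and m :: nat
  assumes graph: "pair_graph G"
    and m_pos: "0 < m"
    and bags: "(\<Union>i<m. X i) = pverts G"
    and arc_in_bag: "(u, v) \<in> parcs G \<Longrightarrow> \<exists>i<m. u \<in> X i \<and> v \<in> X i"
    and in_adhesion: "i < m \<Longrightarrow> s < m \<Longrightarrow> s' < m \<Longrightarrow> desc i s \<Longrightarrow> \<not> desc i s' \<Longrightarrow>
      v \<in> X s \<Longrightarrow> v \<in> X s' \<Longrightarrow> v \<in> X i \<inter> X (par i)"
begin

sublocale pair_graph G
  by (rule graph)

lemma sym_arcs: "sym (parcs G)"
  using pair_sym_arcs by (simp add: symmetric_def)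

text \<open>Each arc lies in a bag. While that bag is below \<open>i\<close>, follow the walk; the
  first arc in another bag starts at a vertex that is also in a bag below \<open>i\<close>, hence in
  the adhesion set. If there is no such arc, the end \<open>y\<close> is such a vertex.\<close>

lemma separation_walk:
  assumes "i < m" "s < m" "s' < m" "desc i s" "\<not> desc i s'" "x \<in> X s" "y \<in> X s'"
    and "(x, y) \<in> parcs G ^^ k"
  shows "\<exists>u\<in>X i \<inter> X (par i). \<exists>p q. p + q = k \<and> (x, u) \<in> parcs G ^^ p \<and> (u, y) \<in> parcs G ^^ q"
  using assms(2,4,6,8)
proof (induction k arbitrary: x s)
  case 0
  then show ?case
    using in_adhesion[of i s s' x] assms by auto
next
  case (Suc k)
  then obtain z where z: "(x, z) \<in> parcs G" "(z, y) \<in> parcs G ^^ k"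
    by (meson relpow_Suc_D2)
  then obtain t where t: "t < m" "x \<in> X t" "z \<in> X t"
    using arc_in_bag by blast
  show ?case
  proof (cases "desc i t")
    case True
    from Suc.IH[OF t(1) True t(3) z(2)] obtain u p q where
      "u \<in> X i \<inter> X (par i)" "p + q = k" "(z, u) \<in> parcs G ^^ p" "(u, y) \<in> parcs G ^^ q"
      by blast
    then have "u \<in> X i \<inter> X (par i) \<and> Suc p + q = Suc k \<and>
        (x, u) \<in> parcs G ^^ Suc p \<and> (u, y) \<in> parcs G ^^ q"
      using relpow_Suc_I2[OF z(1)] by simp
    then show ?thesis
      by blast
  next
    case False
    then have "x \<in> X i \<inter> X (par i)"
      using in_adhesion[of i s t x] Suc.prems t assms(1) by blast
    then show ?thesis
      using Suc.prems(4) by (intro bexI[of _ x] exI[of _ 0] exI[of _ "Suc k"]) auto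
  qed
qed

lemma rooted_decomp: "rooted_decomp par (parcs G) X {..<m} 0"
proof unfold_locales
  fix i :: nat
  show "desc 0 i"
    by (induction i rule: less_induct) (metis desc_par desc_refl gr0I par_less)
next
  fix i s s' x y k
  assume st: "i \<in> {..<m}" "i \<noteq> 0" "s \<in> {..<m}" "s' \<in> {..<m}" "desc i s" "\<not> desc i s'"
    "x \<in> X s" "y \<in> X s'" and "near (parcs G) k x y"
  then obtain j where j: "j \<le> k" "(x, y) \<in> parcs G ^^ j"
    by (auto simp: near_def)
  with st obtain u p q where "u \<in> X i \<inter> X (par i)" "p + q = j"
      "(x, u) \<in> parcs G ^^ p" "(u, y) \<in> parcs G ^^ q"
    using separation_walk[of i s s' x y j] by auto
  then show "\<exists>u\<in>X i \<inter> X (par i). near (parcs G) k x u \<and> near (parcs G) k u y"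
    using j(1) unfolding near_def by (metis le_add1 le_add2 le_trans)
next
  fix i assume "i \<in> {..<m}" "i \<noteq> 0"
  then show "par i \<in> {..<m}"
    using par_le[of i] by simp
qed (use m_pos sym_arcs in auto)

definition adhesions :: "nat \<Rightarrow> 'a set set" where
  "adhesions t = {X t \<inter> X j | j. j < m \<and> (t \<noteq> 0 \<and> j = par t \<or> j \<noteq> 0 \<and> t = par j)}"

text \<open>\<open>A\<close> belongs to the neighbour of \<open>t\<close> on the tree path to
  \<open>s\<close>: the parent if \<open>s\<close> is not below \<open>t\<close>, otherwise a child.
  It depends only on \<open>s\<close> and \<open>t\<close>, so a walk leaves and re-enters the bag
  through the same set.\<close>

lemma leaving_adhesion:
  assumes "t < m" "s < m" "s \<noteq> t"
  obtains A where "A \<in> adhesions t" "A \<subseteq> X t"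
    "\<And>x y k. x \<in> X s \<Longrightarrow> y \<in> X t \<Longrightarrow> (x, y) \<in> parcs G ^^ k \<Longrightarrow>
      \<exists>u\<in>A. \<exists>p q. p + q = k \<and> (x, u) \<in> parcs G ^^ p \<and> (u, y) \<in> parcs G ^^ q"
proof (cases "desc t s")
  case False
  have "t \<noteq> 0"
    using False rooted_decomp.desc_root[OF rooted_decomp, of s] assms(2) by (auto intro: gr0I)
  then have "X t \<inter> X (par t) \<in> adhesions t"
    using assms par_le[of t] by (auto simp: adhesions_def)
  moreover have "\<exists>u\<in>X t \<inter> X (par t). \<exists>p q. p + q = k \<and> (x, u) \<in> parcs G ^^ p \<and> (u, y) \<in> parcs G ^^ q"
    if xy: "x \<in> X s" "y \<in> X t" "(x, y) \<in> parcs G ^^ k" for x y k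
  proof -
    have rev: "(w, v) \<in> parcs G ^^ l" if "(v, w) \<in> parcs G ^^ l" for v w l
      using that
    proof (induction l arbitrary: v)
      case (Suc l)
      then obtain z where "(v, z) \<in> parcs G" "(z, w) \<in> parcs G ^^ l"
        by (meson relpow_Suc_D2)
      with Suc.IH show ?case
        using sym_arcs by (auto dest: symD)
    qed auto
    show ?thesis
      using separation_walk[OF assms(1,1,2) desc_refl False xy(2,1) rev[OF xy(3)]] rev
      by (metis add.commute)
  qed
  ultimately show thesis
    using that by blast
next
  case True
  have "\<exists>j\<le>s. j \<noteq> 0 \<and> par j = t \<and> desc j s"
    using True assms(3)
  proof (induction s rule: less_induct)
    case (less s)
    have "s \<noteq> 0"
      using less.prems desc_le by fastforce
    then have "par s < s" "desc t (par s)"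
      using less.prems par_less by (auto dest: desc_parD)
    show ?case
    proof (cases "par s = t")
      case True
      with \<open>s \<noteq> 0\<close> show ?thesis
        by (intro exI[of _ s]) simp
    next
      case False
      with less.IH[of "par s"] \<open>par s < s\<close> \<open>desc t (par s)\<close> obtain j
        where "j \<le> par s" "j \<noteq> 0" "par j = t" "desc j (par s)"
        by blast
      with \<open>par s < s\<close> show ?thesis
        using desc_par by (intro exI[of _ j]) simp
    qed
  qed
  then obtain j where j: "j \<le> s" "j \<noteq> 0" "par j = t" "desc j s"
    by blast
  then have "j < m" "\<not> desc j t"
    using assms par_less[of j] desc_le[of j t] by auto
  then have "X j \<inter> X (par j) \<in> adhesions t"
    using j by (auto simp: adhesions_def)
  with that show thesis
    using separation_walk[OF \<open>j < m\<close> assms(2,1) j(4) \<open>\<not> desc j t\<close>] j(3) by blast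
qed

end

section \<open>Covers at one scale, expressed by \<open>near\<close>\<close>

definition control_cover :: "nat \<Rightarrow> 'a ugraph \<Rightarrow> real \<Rightarrow> real \<Rightarrow> (nat \<Rightarrow> 'a set set) \<Rightarrow> bool" where
  "control_cover n G r s \<U> \<longleftrightarrow>
    (\<forall>i\<in>{1..n+1}. \<forall>U\<in>\<U> i. U \<subseteq> pverts G) \<and>
    pverts G \<subseteq> (\<Union>i\<in>{1..n+1}. \<Union>(\<U> i)) \<and>
    (\<forall>i\<in>{1..n+1}. \<forall>U\<in>\<U> i. \<forall>U'\<in>\<U> i. U \<noteq> U' \<longrightarrow>
       (\<forall>x\<in>U. \<forall>x'\<in>U'. ereal_of_enat (gdist G x x') > ereal r)) \<and>
    (\<forall>i\<in>{1..n+1}. \<forall>U\<in>\<U> i. \<forall>x\<in>U. \<forall>x'\<in>U. ereal_of_enat (gdist G x x') \<le> ereal s)"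

lemma control_function_iff:
  "control_function n \<F> f \<longleftrightarrow>
    (\<forall>r>0. f r > 0) \<and> (\<forall>G\<in>\<F>. \<forall>r>0. \<exists>\<U>. control_cover n G r (f r) \<U>)"
  unfolding control_function_def control_cover_def ..

text \<open>Finite distances are natural numbers, so the real bound can be rounded down.\<close>

lemma control_functionE:
  assumes "control_function n F f" "H \<in> F" "pair_graph H" "0 < r"
  obtains \<U> where
    "\<And>x. x \<in> pverts H \<Longrightarrow> \<exists>i\<in>{1..n+1}. \<exists>U\<in>\<U> i. x \<in> U"
    "\<And>i U U' x x'. i \<in> {1..n+1} \<Longrightarrow> U \<in> \<U> i \<Longrightarrow> U' \<in> \<U> i \<Longrightarrow> x \<in> U \<Longrightarrow> x' \<in> U' \<Longrightarrow>
      near (parcs H) r x x' \<Longrightarrow> U = U'"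
    "\<And>i U x x'. i \<in> {1..n+1} \<Longrightarrow> U \<in> \<U> i \<Longrightarrow> x \<in> U \<Longrightarrow> x' \<in> U \<Longrightarrow>
      near (parcs H) (nat \<lfloor>f (real r)\<rfloor>) x x'"
proof -
  have "0 < real r"
    using assms(4) by simp
  with assms(1,2) obtain \<U> where "control_cover n H r (f r) \<U>"
    unfolding control_function_iff by blast
  then have
    sub: "\<forall>i\<in>{1..n+1}. \<forall>U\<in>\<U> i. U \<subseteq> pverts H"
    and cover: "pverts H \<subseteq> (\<Union>i\<in>{1..n+1}. \<Union>(\<U> i))"
    and disj: "\<forall>i\<in>{1..n+1}. \<forall>U\<in>\<U> i. \<forall>U'\<in>\<U> i. U \<noteq> U' \<longrightarrow>
       (\<forall>x\<in>U. \<forall>x'\<in>U'. ereal_of_enat (gdist H x x') > ereal (real r))"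
    and bound: "\<forall>i\<in>{1..n+1}. \<forall>U\<in>\<U> i. \<forall>x\<in>U. \<forall>x'\<in>U.
       ereal_of_enat (gdist H x x') \<le> ereal (f (real r))"
    unfolding control_cover_def by - (elim conjE, assumption)+
  show thesis
  proof (rule that[of \<U>])
    fix x assume "x \<in> pverts H"
    with cover show "\<exists>i\<in>{1..n+1}. \<exists>U\<in>\<U> i. x \<in> U"
      by blast
  next
    fix i U U' x x'
    assume *: "i \<in> {1..n+1}" "U \<in> \<U> i" "U' \<in> \<U> i" "x \<in> U" "x' \<in> U'" "near (parcs H) r x x'"
    then have "x \<in> pverts H"
      using sub by blast
    with * have "gdist H x x' \<le> enat r"
      using gdist_le_iff[OF assms(3)] by simp
    then have "ereal_of_enat (gdist H x x') \<le> ereal_of_enat (enat r)"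
      by (simp only: ereal_of_enat_le_iff)
    then have "\<not> ereal_of_enat (gdist H x x') > ereal (real r)"
      by simp
    with disj[rule_format, OF *(1-3) _ *(4,5)] show "U = U'"
      by blast
  next
    fix i U x x'
    assume *: "i \<in> {1..n+1}" "U \<in> \<U> i" "x \<in> U" "x' \<in> U"
    have "gdist H x x' \<le> enat (nat \<lfloor>f (real r)\<rfloor>)"
      using bound[rule_format, OF *] by (cases "gdist H x x'") (auto simp: le_nat_floor)
    moreover have "x \<in> pverts H"
      using sub * by blast
    ultimately show "near (parcs H) (nat \<lfloor>f (real r)\<rfloor>) x x'"
      using gdist_le_iff[OF assms(3)] by simp
  qed
qed

context numbered_decomp
begin

text \<open>The auxiliary graph \<open>H\<close> is compared with \<open>G\<close> in both
  directions: short walks of \<open>G\<close> between bag vertices do not get longer in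
  \<open>H\<close> (\<open>to_H\<close>), and walks of \<open>H\<close> get at most \<open>R\<close>
  times longer in \<open>G\<close> (\<open>from_H\<close>). So a cover of \<open>H\<close> at scale
  \<open>R\<close> yields the colouring. The choice \<open>R = Suc r\<close> keeps the scale
  positive.\<close>

lemma bag_colouring:
  assumes "infinite (UNIV :: 'a set)" "control_function n F' f" "t < m"
    and ext: "\<And>H. vertex_extension (induced G (X t)) (adhesions t) H \<Longrightarrow> H \<in> F'"
  shows "\<exists>c. (\<forall>x. c x \<le> n) \<and> bounded_col (parcs G) (X t) c r (Suc r * nat \<lfloor>f (real (Suc r))\<rfloor>)"
proof -
  define R where "R = Suc r"
  have X_t: "X t \<subseteq> pverts G" "finite (X t)"
    using bags assms(3) pair_finite_verts finite_subset[of "X t" "pverts G"] by auto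
  define P where "P = {(u, v). \<exists>A\<in>adhesions t. u \<in> A \<and> v \<in> A \<and> near (parcs G) R u v}"
  have P_sub: "P \<subseteq> X t \<times> X t"
    by (auto simp: P_def adhesions_def)
  then have "finite P"
    using X_t finite_subset by blast
  \<comment> \<open>The new vertices only have to avoid the bag, and the infinite type has enough of
    them.\<close>
  moreover obtain B where "finite B" "card B = card P" "B \<subseteq> UNIV - X t"
    using infinite_arbitrarily_large[of "UNIV - X t" "card P"] Diff_infinite_finite[OF X_t(2) assms(1)]
    by auto
  ultimately obtain g where "bij_betw g P B"
    using finite_same_card_bij by metis
  with \<open>B \<subseteq> UNIV - X t\<close> have g: "inj_on g P" "g ` P \<inter> X t = {}"
    by (auto simp: bij_betw_def)
  define H where "H = \<lparr>pverts = X t \<union> g ` P,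
    parcs = parcs G \<inter> X t \<times> X t \<union> (\<Union>p\<in>P. {(g p, fst p), (g p, snd p), (fst p, g p), (snd p, g p)})\<rparr>"
  have P_in: "fst p \<in> X t" "snd p \<in> X t" "g p \<notin> X t" if "p \<in> P" for p
    using P_sub g that by auto
  have "pair_graph H"
  proof
    show "finite (pverts H)" "finite (parcs H)"
      using X_t \<open>finite P\<close> by (auto simp: H_def)
    show "fst e \<in> pverts H" "snd e \<in> pverts H" if "e \<in> parcs H" for e
      using that P_in by (auto simp: H_def)
    show "fst e \<noteq> snd e" if "e \<in> parcs H" for e
      using that P_in pair_no_loops by (auto simp: H_def) metis+
    show "symmetric (with_proj H)"
      using sym_arcs by (auto simp: symmetric_def H_def sym_def)
  qed
  have nbrs: "w \<in> {fst p, snd p}" if arc: "(g p, w) \<in> parcs H" and p: "p \<in> P" for p w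
  proof -
    have "(g p, w) \<notin> parcs G \<inter> X t \<times> X t"
      using P_in(3)[OF p] by blast
    then obtain q where q: "q \<in> P" "(g p, w) \<in> {(g q, fst q), (g q, snd q), (fst q, g q), (snd q, g q)}"
      using arc unfolding H_def by auto
    moreover have "g p \<noteq> fst q" "g p \<noteq> snd q"
      using P_in p q(1) by metis+
    ultimately show ?thesis
      using p inj_onD[OF g(1), of p q] by auto
  qed
  have "vertex_extension (induced G (X t)) (adhesions t) H"
    unfolding vertex_extension_def
  proof (intro conjI ballI)
    show "induced H (pverts (induced G (X t))) = induced G (X t)"
      using P_in by (auto simp: induced_def H_def)
  next
    fix v assume "v \<in> pverts H - pverts (induced G (X t))"
    then obtain p where p: "p \<in> P" "v = g p"
      by (auto simp: H_def induced_def)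
    then obtain A where A: "A \<in> adhesions t" "fst p \<in> A" "snd p \<in> A"
      by (auto simp: P_def)
    with p nbrs[of p] show "\<exists>A\<in>adhesions t. {w. (v, w) \<in> parcs H} \<subseteq> A"
      by blast
  qed (use \<open>pair_graph H\<close> in \<open>auto simp: H_def induced_def\<close>)
  then have "H \<in> F'"
    by (rule ext)
  \<comment> \<open>At a new vertex the bound is claimed for both ends of its pair: entering it
    costs the full \<open>R\<close>, leaving it costs nothing.\<close>
  have from_H: "(y \<in> X t \<longrightarrow> near (parcs G) (R * j) x y) \<and>
      (\<forall>p\<in>P. y = g p \<longrightarrow> near (parcs G) (R * j) x (fst p) \<and> near (parcs G) (R * j) x (snd p))"
    if "(x, y) \<in> parcs H ^^ j" "x \<in> X t" for x y j
    using that(1)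
  proof (induction j arbitrary: y)
    case 0
    then show ?case
      using that(2) P_in by auto
  next
    case (Suc j)
    then obtain z where z: "(x, z) \<in> parcs H ^^ j" "(z, y) \<in> parcs H"
      by auto
    note IH = Suc.IH[OF z(1)]
    consider "z \<in> X t" "y \<in> X t" "(z, y) \<in> parcs G" | p where "p \<in> P" "z = g p" "y \<in> {fst p, snd p}"
      | p where "p \<in> P" "y = g p" "z \<in> {fst p, snd p}"
      using z(2) by (auto simp: H_def)
    then show ?case
    proof cases
      case 1
      then have "near (parcs G) (R * j) x z" "near (parcs G) 1 z y"
        using IH by (auto simp: near_def intro!: exI[of _ 1])
      then have "near (parcs G) (R * j + 1) x y"
        by (rule near_trans)
      then show ?thesis
        using 1 P_in by (auto simp: R_def elim: near_mono)
    next
      case 2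
      then have "near (parcs G) (R * j) x y"
        using IH by auto
      then have "near (parcs G) (R * Suc j) x y"
        by (rule near_mono) simp
      moreover have "y \<in> X t"
        using 2(3) P_in(1,2)[OF 2(1)] by blast
      moreover from this have "y \<noteq> g p'" if "p' \<in> P" for p'
        using P_in(3) that by blast
      ultimately show ?thesis
        by blast
    next
      case 3
      have zX: "z \<in> X t"
        using 3(3) P_in(1,2)[OF 3(1)] by blast
      have "near (parcs G) R (fst p) (snd p)"
        using 3 by (auto simp: P_def)
      then have "near (parcs G) R z (fst p)" "near (parcs G) R z (snd p)"
        using 3 near_sym[OF sym_arcs] by auto
      then have "near (parcs G) (R * j + R) x (fst p)" "near (parcs G) (R * j + R) x (snd p)"
        using near_trans[of "parcs G" "R * j" x z R] IH zX by blast+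
      moreover have "p' = p" if "p' \<in> P" "g p' = g p" for p'
        using that 3 g(1) by (auto dest: inj_onD)
      ultimately show ?thesis
        using 3 P_in by (auto simp: add.commute)
    qed
  qed
  have to_H: "near (parcs H) j x y" if "(x, y) \<in> parcs G ^^ j" "j \<le> R" "x \<in> X t" "y \<in> X t" for x y j
    using that
  proof (induction j arbitrary: x rule: less_induct)
    case (less j)
    show ?case
    proof (cases j)
      case 0
      with less.prems show ?thesis by simp
    next
      case (Suc l)
      with less.prems obtain z where z: "(x, z) \<in> parcs G" "(z, y) \<in> parcs G ^^ l"
        by (meson relpow_Suc_D2)
      show ?thesis
      proof (cases "z \<in> X t")
        case True
        then have "near (parcs H) 1 x z"
          using z(1) less.prems by (auto simp: near_def H_def intro!: exI[of _ 1])
        moreover have "near (parcs H) l z y"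
          using less.IH[of l z] z(2) True less.prems Suc by simp
        ultimately have "near (parcs H) (1 + l) x y"
          by (rule near_trans)
        then show ?thesis
          by (simp add: Suc)
      next
        case False
        \<comment> \<open>The walk leaves the bag at \<open>x\<close> and returns at some
          \<open>u\<close> of the same adhesion set; this excursion is replaced by two arcs through
          \<open>g (x, u)\<close>.\<close>
        obtain s where s: "s < m" "x \<in> X s" "z \<in> X s"
          using arc_in_bag z(1) by blast
        then have "s \<noteq> t"
          using False by blast
        then obtain A where A: "A \<in> adhesions t" "A \<subseteq> X t" and
          exit: "\<And>x y k. x \<in> X s \<Longrightarrow> y \<in> X t \<Longrightarrow> (x, y) \<in> parcs G ^^ k \<Longrightarrow>
            \<exists>u\<in>A. \<exists>p q. p + q = k \<and> (x, u) \<in> parcs G ^^ p \<and> (u, y) \<in> parcs G ^^ q"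
          using leaving_adhesion assms(3) s(1) by metis
        \<comment> \<open>Use the walk of length 0 at \<open>x\<close>, which lies in both
          \<open>X s\<close> and \<open>X t\<close>.\<close>
        have "x \<in> A"
          using exit[of x x 0] s less.prems by auto
        from exit[OF s(3) less.prems(4) z(2)] obtain u p q where
          u: "u \<in> A" "p + q = l" "(z, u) \<in> parcs G ^^ p" "(u, y) \<in> parcs G ^^ q"
          by blast
        \<comment> \<open>So the excursion has length \<open>Suc p\<close>, at least 2, and the two
          new arcs are no longer.\<close>
        have "p \<noteq> 0"
          using u A False by (cases p) auto
        have "(x, u) \<in> parcs G ^^ Suc p"
          using z(1) u(3) by (rule relpow_Suc_I2)
        then have "near (parcs G) R x u"
          using u less.prems Suc by (auto simp: near_def intro!: exI[of _ "Suc p"])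
        then have "(x, u) \<in> P"
          using \<open>x \<in> A\<close> u A by (auto simp: P_def)
        then have "(x, g (x, u)) \<in> parcs H" "(g (x, u), u) \<in> parcs H"
          by (force simp: H_def)+
        then have "(x, u) \<in> parcs H ^^ 2"
          by (auto simp: numeral_2_eq_2)
        then have "near (parcs H) (Suc p) x u"
          using \<open>p \<noteq> 0\<close> by (auto simp: near_def intro!: exI[of _ 2])
        moreover have "near (parcs H) q u y"
          using less.IH[of q u] u A less.prems Suc by auto
        ultimately have "near (parcs H) (Suc p + q) x y"
          by (rule near_trans)
        then show ?thesis
          using u(2) Suc by simp
      qed
    qed
  qed
  obtain \<U> where
    cover: "\<And>x. x \<in> pverts H \<Longrightarrow> \<exists>i\<in>{1..n+1}. \<exists>U\<in>\<U> i. x \<in> U"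
    and disjoint: "\<And>i U U' x x'. i \<in> {1..n+1} \<Longrightarrow> U \<in> \<U> i \<Longrightarrow> U' \<in> \<U> i \<Longrightarrow> x \<in> U \<Longrightarrow> x' \<in> U' \<Longrightarrow>
      near (parcs H) R x x' \<Longrightarrow> U = U'"
    and small: "\<And>i U x x'. i \<in> {1..n+1} \<Longrightarrow> U \<in> \<U> i \<Longrightarrow> x \<in> U \<Longrightarrow> x' \<in> U \<Longrightarrow>
      near (parcs H) (nat \<lfloor>f (real R)\<rfloor>) x x'"
    using control_functionE[OF assms(2) \<open>H \<in> F'\<close> \<open>pair_graph H\<close>, of R] unfolding R_def by blast
  define idx where "idx x = (SOME i. i \<in> {1..n+1} \<and> (\<exists>U\<in>\<U> i. x \<in> U))" for x
  have idx: "idx x \<in> {1..n+1}" "\<exists>U\<in>\<U> (idx x). x \<in> U" if "x \<in> X t" for x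
  proof -
    have "\<exists>i. i \<in> {1..n+1} \<and> (\<exists>U\<in>\<U> i. x \<in> U)"
      using cover[of x] that by (auto simp: H_def)
    from someI_ex[OF this] show "idx x \<in> {1..n+1}" "\<exists>U\<in>\<U> (idx x). x \<in> U"
      unfolding idx_def by blast+
  qed
  \<comment> \<open>Cover indices run from 1 to \<open>n + 1\<close>, colours from 0 to
    \<open>n\<close>.\<close>
  define c where "c x = (if x \<in> X t then idx x - 1 else 0)" for x
  have "bounded_col (parcs G) (X t) c r (R * nat \<lfloor>f (real R)\<rfloor>)"
    unfolding bounded_col_def
  proof (intro allI impI)
    fix x y assume xy: "(x, y) \<in> (mono_step (parcs G) (X t) c r)\<^sup>*"
    show "near (parcs G) (R * nat \<lfloor>f (real R)\<rfloor>) x y"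
    proof (cases "x \<in> X t")
      case False
      with xy have "x = y"
        by (auto simp: mono_step_def elim: converse_rtranclE)
      then show ?thesis by simp
    next
      case True
      obtain U where U: "U \<in> \<U> (idx x)" "x \<in> U"
        using idx(2)[OF True] by blast
      from xy have "y \<in> U \<and> y \<in> X t"
      proof induction
        case base
        with U True show ?case by simp
      next
        case (step y z)
        then have yz: "y \<in> X t" "z \<in> X t" "c y = c z" "near (parcs G) r y z" "y \<in> U"
          by (auto simp: mono_step_def)
        have "c x = c y"
          using step.hyps(1) by induction (auto simp: mono_step_def)
        then have "idx z = idx x"
          using yz idx(1)[of x] idx(1)[of z] True by (auto simp: c_def)
        then obtain U' where U': "U' \<in> \<U> (idx x)" "z \<in> U'"
          using idx(2)[OF yz(2)] by auto
        obtain j where "j \<le> r" "(y, z) \<in> parcs G ^^ j"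
          using yz(4) by (auto simp: near_def)
        then have "near (parcs H) R y z"
          using to_H[of y z j] yz(1,2) near_mono[of "parcs H" j y z R] by (simp add: R_def)
        then have "U = U'"
          using disjoint[OF idx(1)[OF True] U(1) U'(1) yz(5) U'(2)] by blast
        with U' yz show ?case by simp
      qed
      then have "near (parcs H) (nat \<lfloor>f (real R)\<rfloor>) x y"
        using small[OF idx(1)[OF True] U(1) U(2)] by blast
      then obtain j where "j \<le> nat \<lfloor>f (real R)\<rfloor>" "(x, y) \<in> parcs H ^^ j"
        by (auto simp: near_def)
      then show ?thesis
        using from_H[of x y j] True \<open>y \<in> U \<and> y \<in> X t\<close> near_mono[of "parcs G" "R * j" x y] by simp
    qed
  qed
  moreover have "c x \<le> n" for x
    using idx(1)[of x] by (auto simp: c_def)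
  ultimately show ?thesis
    unfolding R_def by blast
qed

end

section \<open>Asymptotic dimension\<close>

text \<open>The cover consists of the monochromatic chain components at the integer scale
  \<open>nat \<lceil>r\<rceil>\<close>: points of one colour at distance at most \<open>r\<close>
  share a component. The summand 1 makes the control function positive.\<close>

lemma control_function_of_colourings:
  assumes "graph_class F"
    and colouring: "\<And>G r. G \<in> F \<Longrightarrow>
      \<exists>c. (\<forall>x. c x \<le> n) \<and> bounded_col (parcs G) (pverts G) c r (D r)"
  shows "control_function n F (\<lambda>r. real (D (nat \<lceil>r\<rceil>)) + 1)"
  unfolding control_function_iff
proof (intro conjI allI impI ballI)
  fix G and r :: real
  assume G: "G \<in> F" and "0 < r"
  then have graph: "pair_graph G"
    using assms(1) by (simp add: graph_class_def)
  then have sym: "sym (parcs G)"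
    by (simp add: pair_graph_def pair_pseudo_graph_def pair_sym_digraph_def
        pair_sym_digraph_axioms_def symmetric_def)
  define R where "R = nat \<lceil>r\<rceil>"
  obtain c where c: "\<And>x. c x \<le> n" "bounded_col (parcs G) (pverts G) c R (D R)"
    using colouring[OF G] by blast
  define M where "M = mono_step (parcs G) (pverts G) c R"
  have M_col: "c y = c x \<and> (x \<in> pverts G \<longrightarrow> y \<in> pverts G)" if "(x, y) \<in> M\<^sup>*" for x y
    using that by induction (auto simp: M_def mono_step_def)
  have M_sym: "(y, x) \<in> M\<^sup>*" if "(x, y) \<in> M\<^sup>*" for x y
    using sym_mono_step[OF sym] that unfolding M_def by (meson symD)
  define \<U> where "\<U> i = {M\<^sup>* `` {x} | x. x \<in> pverts G \<and> i = Suc (c x)}" for i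
  show "\<exists>\<U>. control_cover n G r (real (D (nat \<lceil>r\<rceil>)) + 1) \<U>"
    unfolding control_cover_def
  proof (intro exI[of _ \<U>] conjI ballI impI)
    fix i U assume "U \<in> \<U> i"
    then show "U \<subseteq> pverts G"
      using M_col by (auto simp: \<U>_def)
  next
    show "pverts G \<subseteq> (\<Union>i\<in>{1..n+1}. \<Union>(\<U> i))"
    proof
      fix x assume "x \<in> pverts G"
      then have "x \<in> M\<^sup>* `` {x}" "M\<^sup>* `` {x} \<in> \<U> (Suc (c x))" "Suc (c x) \<in> {1..n+1}"
        using c(1)[of x] by (auto simp: \<U>_def)
      then show "x \<in> (\<Union>i\<in>{1..n+1}. \<Union>(\<U> i))"
        by blast
    qed
  next
    fix i U U' x x'
    assume "U \<in> \<U> i" "U' \<in> \<U> i" "U \<noteq> U'" and xx: "x \<in> U" "x' \<in> U'"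
    then obtain v v' where v: "U = M\<^sup>* `` {v}" "U' = M\<^sup>* `` {v'}" "v \<in> pverts G" "v' \<in> pverts G" "c v = c v'"
      by (auto simp: \<U>_def)
    with xx have col: "(v, x) \<in> M\<^sup>*" "(v', x') \<in> M\<^sup>*" "c x = c x'" "x \<in> pverts G" "x' \<in> pverts G"
      using M_col by auto
    show "ereal_of_enat (gdist G x x') > ereal r"
    proof (rule ccontr)
      assume "\<not> ereal_of_enat (gdist G x x') > ereal r"
      then obtain k where k: "gdist G x x' = enat k" "real k \<le> r"
        by (cases "gdist G x x'") auto
      then have "gdist G x x' \<le> enat R"
        using nat_mono[OF ceiling_mono[OF k(2)]] by (simp add: R_def)
      then have "near (parcs G) R x x'"
        using gdist_le_iff[OF graph col(4)] by simp
      with col have "(x, x') \<in> M\<^sup>*"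
        by (auto simp: M_def mono_step_def)
      then have "(v, v') \<in> M\<^sup>*"
        using col M_sym by (meson rtrancl_trans)
      then have "U = U'"
        unfolding v using M_sym by (auto intro: rtrancl_trans)
      with \<open>U \<noteq> U'\<close> show False ..
    qed
  next
    fix i U x x'
    assume "U \<in> \<U> i" and xx: "x \<in> U" "x' \<in> U"
    then obtain v where v: "U = M\<^sup>* `` {v}" "v \<in> pverts G"
      by (auto simp: \<U>_def)
    with xx have "(x, x') \<in> M\<^sup>*" "x \<in> pverts G"
      using M_sym M_col by (auto intro: rtrancl_trans)
    then have "gdist G x x' \<le> enat (D R)"
      using c(2) gdist_le_iff[OF graph] unfolding M_def by (auto dest: bounded_colD)
    then have "ereal_of_enat (gdist G x x') \<le> ereal_of_enat (enat (D R))"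
      by (simp only: ereal_of_enat_le_iff)
    then show "ereal_of_enat (gdist G x x') \<le> ereal (real (D (nat \<lceil>r\<rceil>)) + 1)"
      by (rule order_trans) (simp add: R_def)
  qed
qed simp

lemma vertex_extension_mono:
  "vertex_extension G \<A> H \<Longrightarrow> \<A> \<subseteq> \<B> \<Longrightarrow> vertex_extension G \<B> H"
  unfolding vertex_extension_def by (meson subsetD)

lemma control_function_mono:
  assumes "control_function n F f" "n \<le> n'"
  shows "control_function n' F f"
  unfolding control_function_iff
proof (intro conjI ballI allI impI)
  show "f r > 0" if "r > 0" for r
    using assms(1) that by (simp add: control_function_def)
  fix G and r :: real assume "G \<in> F" "0 < r"
  with assms(1) obtain \<U> where "control_cover n G r (f r) \<U>"
    unfolding control_function_iff by blast
  then have
    sub: "\<forall>i\<in>{1..n+1}. \<forall>U\<in>\<U> i. U \<subseteq> pverts G"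
    and cover: "pverts G \<subseteq> (\<Union>i\<in>{1..n+1}. \<Union>(\<U> i))"
    and disj: "\<forall>i\<in>{1..n+1}. \<forall>U\<in>\<U> i. \<forall>U'\<in>\<U> i. U \<noteq> U' \<longrightarrow>
       (\<forall>x\<in>U. \<forall>x'\<in>U'. ereal_of_enat (gdist G x x') > ereal r)"
    and bound: "\<forall>i\<in>{1..n+1}. \<forall>U\<in>\<U> i. \<forall>x\<in>U. \<forall>x'\<in>U.
       ereal_of_enat (gdist G x x') \<le> ereal (f r)"
    unfolding control_cover_def by - (elim conjE, assumption)+
  define \<V> where "\<V> i = (if i \<le> n + 1 then \<U> i else {})" for i
  have \<V>: "i \<in> {1..n+1} \<and> U \<in> \<U> i" if "i \<in> {1..n'+1}" "U \<in> \<V> i" for i U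
    using that by (auto simp: \<V>_def split: if_splits)
  have "\<U> i = \<V> i" "i \<in> {1..n'+1}" if "i \<in> {1..n+1}" for i
    using that \<open>n \<le> n'\<close> by (auto simp: \<V>_def)
  then have "(\<Union>i\<in>{1..n+1}. \<Union>(\<U> i)) \<subseteq> (\<Union>i\<in>{1..n'+1}. \<Union>(\<V> i))"
    by blast
  with cover have "pverts G \<subseteq> (\<Union>i\<in>{1..n'+1}. \<Union>(\<V> i))"
    by (rule order_trans)
  then have "control_cover n' G r (f r) \<V>"
    unfolding control_cover_def
  proof (intro conjI ballI impI)
    fix i U assume "i \<in> {1..n'+1}" "U \<in> \<V> i"
    note U = \<V>[OF this]
    then show "U \<subseteq> pverts G"
      using sub by blast
    show "ereal_of_enat (gdist G x x') \<le> ereal (f r)" if "x \<in> U" "x' \<in> U" for x x'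
      using bound U that by blast
    fix U' x x' assume "U' \<in> \<V> i" "U \<noteq> U'" "x \<in> U" "x' \<in> U'"
    then show "ereal_of_enat (gdist G x x') > ereal r"
      using disj U \<V>[of i U'] \<open>i \<in> {1..n'+1}\<close> by blast
  qed
  then show "\<exists>\<U>. control_cover n' G r (f r) \<U>"
    by blast
qed

lemma tree_decomposition_numbering:
  assumes td: "tree_decomposition T X G" and graph: "pair_graph G"
  obtains par nd m where "numbered_decomp par G (X \<circ> nd) m" "nd ` {..<m} \<subseteq> pverts T"
    "\<And>i. i < m \<Longrightarrow> i \<noteq> 0 \<Longrightarrow> (nd i, nd (par i)) \<in> parcs T \<and> (nd (par i), nd i) \<in> parcs T"
proof -
  have tree: "is_tree T"
    using td by (simp add: tree_decomposition_def)
  then interpret T: pair_graph T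
    by (simp add: is_tree_def)
  have sym_T: "sym (parcs T)"
    using T.pair_sym_arcs by (simp add: symmetric_def)
  define m where "m = card (pverts T)"
  obtain par nd where num: "tree_numbering T par nd m"
    using tree_numbering_exists[OF tree] unfolding m_def by blast
  then have par_tree: "par_tree par"
    by (simp add: tree_numbering_def)
  then interpret par_tree par .
  have nd: "0 < m" "inj_on nd {..<m}" "nd ` {..<m} \<subseteq> pverts T"
    and par_arc: "\<And>i. i < m \<Longrightarrow> i \<noteq> 0 \<Longrightarrow> (nd i, nd (par i)) \<in> parcs T"
    and arc_par: "\<And>i j. i < m \<Longrightarrow> j < m \<Longrightarrow> (nd i, nd j) \<in> parcs T \<Longrightarrow>
      i \<noteq> 0 \<and> j = par i \<or> j \<noteq> 0 \<and> i = par j"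
    using num by (auto simp: tree_numbering_def)
  have nd_onto: "nd ` {..<m} = pverts T"
    using nd T.pair_finite_verts by (intro card_subset_eq) (auto simp: card_image m_def)
  have "numbered_decomp par G (X \<circ> nd) m"
  proof (intro numbered_decomp.intro numbered_decomp_axioms.intro)
    show "par_tree par" "pair_graph G" "0 < m"
      by (fact par_tree graph nd(1))+
    show "(\<Union>i<m. (X \<circ> nd) i) = pverts G"
      using td unfolding tree_decomposition_def nd_onto[symmetric] by auto
    show "\<exists>i<m. u \<in> (X \<circ> nd) i \<and> v \<in> (X \<circ> nd) i" if "(u, v) \<in> parcs G" for u v
      using td that unfolding tree_decomposition_def nd_onto[symmetric] by fastforce
    fix i s s' v
    assume st: "i < m" "s < m" "s' < m" "desc i s" "\<not> desc i s'" "v \<in> (X \<circ> nd) s" "v \<in> (X \<circ> nd) s'"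
    \<comment> \<open>The nodes whose bags contain \<open>v\<close> are connected and meet both the
      subtree below \<open>i\<close> and its complement; the only tree edge between these two joins
      \<open>i\<close> and \<open>par i\<close>.\<close>
    define H where "H = induced T {t \<in> pverts T. v \<in> X t}"
    have "v \<in> pverts G"
      using td st nd unfolding tree_decomposition_def by auto
    then have "Digraph_Component.connected (with_proj H)"
      using td by (simp add: tree_decomposition_def H_def)
    moreover have "sym (parcs H)"
      using sym_T by (auto simp: H_def induced_def sym_def)
    moreover have "nd s \<in> pverts H" "nd s' \<in> pverts H"
      using st nd by (auto simp: H_def induced_def)
    moreover have "nd s \<in> nd ` {j\<in>{..<m}. desc i j}"
      using st by auto
    moreover have "nd s' \<notin> nd ` {j\<in>{..<m}. desc i j}"
      using st inj_on_image_mem_iff[OF nd(2), of s' "{j\<in>{..<m}. desc i j}"] by auto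
    ultimately obtain p q where pq: "(p, q) \<in> parcs H" "p \<in> nd ` {j\<in>{..<m}. desc i j}"
        "q \<notin> nd ` {j\<in>{..<m}. desc i j}"
      by (rule connected_crossing_arc)
    then have "q \<in> nd ` {..<m}"
      unfolding nd_onto by (auto simp: H_def induced_def)
    with pq obtain j l where jl: "j < m" "l < m" "desc i j" "\<not> desc i l" "p = nd j" "q = nd l"
      by auto
    with pq have arc: "(nd j, nd l) \<in> parcs T" "v \<in> X (nd j)" "v \<in> X (nd l)"
      by (auto simp: H_def induced_def)
    from arc_par[OF jl(1,2) arc(1)] have "j = i \<and> l = par i"
      using jl(3,4) desc_par[of i l] desc_parD[of i j] by auto
    with arc show "v \<in> (X \<circ> nd) i \<inter> (X \<circ> nd) (par i)"
      by simp
  qed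
  with that nd(3) par_arc symD[OF sym_T] show thesis
    by metis
qed

theorem theorem5p2:
  fixes \<F> \<F>' \<F>star :: "'a ugraph set"
    and \<theta> :: nat
  assumes "infinite (UNIV :: 'a set)"
    and "graph_class \<F>" and "hereditary \<F>"
    and "graph_class \<F>'" and "hereditary \<F>'"
    and "graph_class \<F>star"
    and "\<theta> > 0"
    and "\<And>G. G \<in> \<F>star \<Longrightarrow>
      \<exists>(T :: 't ugraph) X. tree_decomposition T X G \<and> adhesion T X \<le> \<theta> \<and>
        (\<forall>t\<in>pverts T.
           induced G (X t) \<in> \<F> \<and>
           (\<forall>H. vertex_extension (induced G (X t)) {X t \<inter> X t' | t'. (t, t') \<in> parcs T} H
              \<longrightarrow> H \<in> \<F>'))"
  shows "asdim \<F>star \<le> max (max (asdim \<F>) (asdim \<F>')) 1"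
proof (cases "{n. \<exists>f. control_function n \<F>' f} = {}")
  \<comment> \<open>An infimum over the empty set is \<infinity>, so the right-hand side is
    infinite.\<close>
  case True
  have "asdim \<F>' = \<infinity>"
    unfolding asdim_def True by (simp add: top_enat_def)
  then have "\<infinity> \<le> max (max (asdim \<F>) (asdim \<F>')) 1"
    by (simp add: le_max_iff_disj del: enat_ord_simps)
  then show ?thesis
    by (rule order_trans[rotated]) simp
next
  case False
  define n0 where "n0 = (LEAST n. \<exists>f. control_function n \<F>' f)"
  have "\<exists>n f. control_function n \<F>' f"
    using False by blast
  from LeastI_ex[OF this] obtain f where f: "control_function n0 \<F>' f"
    unfolding n0_def by blast
  have "enat n0 \<le> asdim \<F>'"
    unfolding asdim_def n0_def by (auto intro!: INF_greatest Least_le)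
  \<comment> \<open>The maximum with 1 provides the two colours that the rings use.\<close>
  define n where "n = max n0 1"
  have f_n: "control_function n \<F>' f" and "1 \<le> n"
    using control_function_mono[OF f] by (auto simp: n_def)
  define Db where "Db r = Suc r * nat \<lfloor>f (real (Suc r))\<rfloor>" for r
  \<comment> \<open>The induction is entered without centres, \<open>k = 0\<close>, so that \<theta>
    bounds the whole adhesion sets.\<close>
  have "\<forall>r. \<exists>D. \<forall>(E :: 'a rel) X par N a Z.
    rooted_decomp par E X N a \<longrightarrow> finite Z \<longrightarrow> card Z \<le> 0 \<longrightarrow>
    (\<forall>i\<in>N. i \<noteq> a \<longrightarrow> finite (X i \<inter> X (par i)) \<and> card (X i \<inter> X (par i) - nbhd E Z 0) \<le> \<theta>) \<longrightarrow>
    (\<forall>i\<in>N. \<forall>r. \<exists>c. (\<forall>x. c x \<le> n) \<and> bounded_col E (X i) c r (Db r)) \<longrightarrow>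
    (\<exists>c. (\<forall>x. c x \<le> n) \<and> bounded_col E (\<Union>i\<in>N. X i) c r D)"
    by (intro allI colouring_adhesions_partly_covered \<open>1 \<le> n\<close>)
  from choice[OF this] obtain D where "\<forall>r. \<forall>(E :: 'a rel) X par N a Z.
    rooted_decomp par E X N a \<longrightarrow> finite Z \<longrightarrow> card Z \<le> 0 \<longrightarrow>
    (\<forall>i\<in>N. i \<noteq> a \<longrightarrow> finite (X i \<inter> X (par i)) \<and> card (X i \<inter> X (par i) - nbhd E Z 0) \<le> \<theta>) \<longrightarrow>
    (\<forall>i\<in>N. \<forall>r. \<exists>c. (\<forall>x. c x \<le> n) \<and> bounded_col E (X i) c r (Db r)) \<longrightarrow>
    (\<exists>c. (\<forall>x. c x \<le> n) \<and> bounded_col E (\<Union>i\<in>N. X i) c r (D r))" ..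
  note D = this[rule_format]
  have "\<exists>c. (\<forall>x. c x \<le> n) \<and> bounded_col (parcs G) (pverts G) c r (D r)" if G: "G \<in> \<F>star" for G r
  proof -
    have graph: "pair_graph G"
      using assms(6) G by (simp add: graph_class_def)
    obtain T :: "'t ugraph" and X where T: "tree_decomposition T X G" "adhesion T X \<le> \<theta>"
      and ext: "\<And>t H. t \<in> pverts T \<Longrightarrow>
        vertex_extension (induced G (X t)) {X t \<inter> X t' | t'. (t, t') \<in> parcs T} H \<Longrightarrow> H \<in> \<F>'"
      using assms(8)[OF G] by blast
    interpret T: pair_graph T
      using T(1) by (simp add: tree_decomposition_def is_tree_def)
    obtain par nd m where num: "numbered_decomp par G (X \<circ> nd) m" "nd ` {..<m} \<subseteq> pverts T"
      and par_arc: "\<And>i. i < m \<Longrightarrow> i \<noteq> 0 \<Longrightarrow> (nd i, nd (par i)) \<in> parcs T \<and> (nd (par i), nd i) \<in> parcs T"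
      using tree_decomposition_numbering[OF T(1) graph] by blast
    interpret numbered_decomp par G "X \<circ> nd" m
      by fact
    have adh: "card (X t \<inter> X t') \<le> \<theta>" if "(t, t') \<in> parcs T" for t t'
    proof -
      have "card (X t \<inter> X t') \<le> adhesion T X"
        unfolding adhesion_def using that T.pair_finite_arcs
        by (intro cSUP_upper2[where x = "(t, t')"]) auto
      with T(2) show ?thesis by simp
    qed
    have "\<exists>c. (\<forall>x. c x \<le> n) \<and> bounded_col (parcs G) (\<Union>i\<in>{..<m}. (X \<circ> nd) i) c r (D r)"
    proof (rule D[OF rooted_decomp, of "{}"])
      fix i assume i: "i \<in> {..<m}" "i \<noteq> 0"
      then have "(X \<circ> nd) i \<subseteq> pverts G"
        using bags by blast
      then have "finite ((X \<circ> nd) i)"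
        using pair_finite_verts by (rule finite_subset)
      then show "finite ((X \<circ> nd) i \<inter> (X \<circ> nd) (par i)) \<and>
          card ((X \<circ> nd) i \<inter> (X \<circ> nd) (par i) - nbhd (parcs G) {} 0) \<le> \<theta>"
        using i adh par_arc[of i] by (auto simp: nbhd_def)
    next
      fix i r assume i: "i \<in> {..<m}"
      show "\<exists>c. (\<forall>x. c x \<le> n) \<and> bounded_col (parcs G) ((X \<circ> nd) i) c r (Db r)"
        unfolding Db_def
      proof (rule bag_colouring[OF assms(1) f_n])
        fix H assume "vertex_extension (induced G ((X \<circ> nd) i)) (adhesions i) H"
        \<comment> \<open>Parents and children in the numbering are neighbours in \<open>T\<close>,
          so the extensions used for the bag are among those that the hypothesis puts into
          \<F>'.\<close>
        moreover have "adhesions i \<subseteq> {X (nd i) \<inter> X t' | t'. (nd i, t') \<in> parcs T}"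
          using par_arc i by (auto simp: adhesions_def)
        ultimately have "vertex_extension (induced G (X (nd i)))
            {X (nd i) \<inter> X t' | t'. (nd i, t') \<in> parcs T} H"
          unfolding comp_apply by (rule vertex_extension_mono)
        then show "H \<in> \<F>'"
          using ext num(2) i by blast
      qed (use i in simp)
    qed simp_all
    then show ?thesis
      using bags by simp
  qed
  then have "control_function n \<F>star (\<lambda>r. real (D (nat \<lceil>r\<rceil>)) + 1)"
    by (rule control_function_of_colourings[OF assms(6)])
  then have "asdim \<F>star \<le> enat n"
    unfolding asdim_def by (auto intro: INF_lower)
  also have "\<dots> = max (enat n0) 1"
    by (simp add: n_def one_enat_def)
  also have "\<dots> \<le> max (max (asdim \<F>) (asdim \<F>')) 1"
    using \<open>enat n0 \<le> asdim \<F>'\<close> by (auto simp: max_def)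
  finally show ?thesis .
qed

end
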